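(* Let $\mathcal{V}$ be a semi-abelian variety of algebras. For any two algebras $K$ and $Q$ in $\mathcal{V}$, the conglomerate $\mathrm{Ext}^1(Q,K)$ of one-step extensions under $K$ and over $Q$ is small, i.e., it admits a bijection to a set.
   Context: Foundations: one works in ZFC with a fixed Grothendieck universe $\mathcal{U}$ (containing $\mathbb{N}$). The objects satisfying the ZFC axioms are called conglomerates; the elements of $\mathcal{U}$ are called sets, and the subconglomerates of $\mathcal{U}$ are called classes. A conglomerate is small when it admits a bijection to a set (an element of $\mathcal{U}$). Categories have classes of objects and arrows. The algebras of a variety have sets as underlying sets, and the signature of a variety is a set of finitary operations. A category is semi-abelian when it is pointed, Barr exact, Bourn protomodular and has finite coproducts. A semi-abelian variety is a variety of algebras (in the sense of universal algebra) which is semi-abelian as a category. By a theorem of Bourn and Janelidze, a variety is semi-abelian if and only if its free algebra on the empty set is a singleton (so there is a unique constant $0$) and there exist an integer $\ell\geq 1$, binary operations $\alpha_1,\dots,\alpha_\ell$ satisfying $\alpha_i(x,x)=0$ for all $i$, and an $(\ell+1)$-ary operation $\beta$ satisfying $\beta(\alpha_1(x,y),\dots,\alpha_\ell(x,y),y)=x$. In a pointed category with kernels and cokernels, a short exact sequence from $K$ to $Q$, written $0\to K\xrightarrow{k} X\xrightarrow{q} Q\to 0$, is a pair $(k,q)$ such that $k$ is a kernel of $q$ and $q$ is a cokernel of $k$. Let $\mathsf{Ext}^1(Q,K)$ be the category whose objects are the short exact sequences from $K$ to $Q$, and whose morphisms $(k\colon K\to X,\,q\colon X\to Q)\to(k'\colon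 K\to X',\,q'\colon X'\to Q)$ are the morphisms $\xi\colon X\to X'$ with $\xi k=k'$ and $q'\xi=q$. The one-step extensions under $K$ and over $Q$ are the connected components of this category (two objects being in the same component if and only if they are joined by a finite zigzag of morphisms), and $\mathrm{Ext}^1(Q,K)=\pi_0(\mathsf{Ext}^1(Q,K))$ is the conglomerate of these. *)

theory Defs
  imports Main "HOL-Library.FuncSet"
begin

section \<open>The universe\<close>

text \<open>
  The type \<open>'u\<close> plays the role of the Grothendieck universe. Its elements are the sets,
  \<open>elts x\<close> is the extension of the set \<open>x\<close>, HOL sets of type \<open>'u set\<close> are the
  classes, and HOL sets over arbitrary types built from \<open>'u\<close> are conglomerates.
  Transitivity of the universe is automatic, because \<open>elts\<close> takes values in \<open>'u set\<close>. The power
  set axiom says that \<^emph>\<open>all\<close> subconglomerates of a set are sets, and that together they form a set.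
\<close>

locale grothendieck_universe =
  fixes elts :: "'u \<Rightarrow> 'u set"
  assumes extensionality: "inj elts"
    and foundation: "wf {(x, y). x \<in> elts y}"
    and pairing: "\<exists>z. elts z = {x, y}"
    and power_set: "\<exists>p. elts ` elts p = Pow (elts x)"
    and union: "\<exists>z. elts z = (\<Union>i\<in>elts I. elts (F i))"
    and infinity: "\<exists>w. (\<exists>z\<in>elts w. elts z = {}) \<and>
      (\<forall>x\<in>elts w. \<exists>y\<in>elts w. elts y = insert x (elts x))"

definition small :: "('u \<Rightarrow> 'u set) \<Rightarrow> 'b set \<Rightarrow> bool" where
  "small elts S \<longleftrightarrow> (\<exists>u f. bij_betw f S (elts u))"


section \<open>Categories\<close>

record ('o, 'a) cat =
  Obj :: "'o set"
  Arr :: "'a set"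
  Dom :: "'a \<Rightarrow> 'o"
  Cod :: "'a \<Rightarrow> 'o"
  Id :: "'o \<Rightarrow> 'a"
  Comp :: "'a \<Rightarrow> 'a \<Rightarrow> 'a"  (infixl "\<cdot>\<index>" 70)

definition hom :: "('o, 'a) cat \<Rightarrow> 'o \<Rightarrow> 'o \<Rightarrow> 'a set" where
  "hom C A B = {f \<in> Arr C. Dom C f = A \<and> Cod C f = B}"

locale category =
  fixes C :: "('o, 'a) cat" (structure)
  assumes Dom_Obj: "f \<in> Arr C \<Longrightarrow> Dom C f \<in> Obj C"
    and Cod_Obj: "f \<in> Arr C \<Longrightarrow> Cod C f \<in> Obj C"
    and Id_hom: "A \<in> Obj C \<Longrightarrow> Id C A \<in> hom C A A"
    and Comp_hom: "f \<in> hom C A B \<Longrightarrow> g \<in> hom C B D \<Longrightarrow> g \<cdot> f \<in> hom C A D"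
    and Comp_Id: "f \<in> hom C A B \<Longrightarrow> f \<cdot> Id C A = f"
    and Id_Comp: "f \<in> hom C A B \<Longrightarrow> Id C B \<cdot> f = f"
    and Comp_assoc: "f \<in> hom C A B \<Longrightarrow> g \<in> hom C B D \<Longrightarrow> h \<in> hom C D E \<Longrightarrow>
      h \<cdot> (g \<cdot> f) = (h \<cdot> g) \<cdot> f"

definition connected_components :: "('o, 'a) cat \<Rightarrow> 'o set set" where
  "connected_components C =
    Obj C // {(A, B) \<in> Obj C \<times> Obj C. hom C A B \<noteq> {} \<or> hom C B A \<noteq> {}}\<^sup>*"

definition iso :: "('o, 'a) cat \<Rightarrow> 'a \<Rightarrow> bool" where
  "iso C f \<longleftrightarrow> f \<in> Arr C \<and>
    (\<exists>g \<in> hom C (Cod C f) (Dom C f).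
      g \<cdot>\<^bsub>C\<^esub> f = Id C (Dom C f) \<and> f \<cdot>\<^bsub>C\<^esub> g = Id C (Cod C f))"


subsection \<open>Pointed categories\<close>

definition initial :: "('o, 'a) cat \<Rightarrow> 'o \<Rightarrow> bool" where
  "initial C Z \<longleftrightarrow> Z \<in> Obj C \<and> (\<forall>A \<in> Obj C. \<exists>!f. f \<in> hom C Z A)"

definition terminal :: "('o, 'a) cat \<Rightarrow> 'o \<Rightarrow> bool" where
  "terminal C Z \<longleftrightarrow> Z \<in> Obj C \<and> (\<forall>A \<in> Obj C. \<exists>!f. f \<in> hom C A Z)"

definition zero_object :: "('o, 'a) cat \<Rightarrow> 'o \<Rightarrow> bool" where
  "zero_object C Z \<longleftrightarrow> initial C Z \<and> terminal C Z"

definition pointed :: "('o, 'a) cat \<Rightarrow> bool" where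
  "pointed C \<longleftrightarrow> (\<exists>Z. zero_object C Z)"

definition zero_arrow :: "('o, 'a) cat \<Rightarrow> 'a \<Rightarrow> bool" where
  "zero_arrow C f \<longleftrightarrow> f \<in> Arr C \<and>
    (\<exists>Z. zero_object C Z \<and> (\<exists>g \<in> hom C (Dom C f) Z. \<exists>h \<in> hom C Z (Cod C f). f = h \<cdot>\<^bsub>C\<^esub> g))"

text \<open>\<open>kernel C q k\<close>: the arrow \<open>k\<close> is a kernel of \<open>q\<close>;
  \<open>cokernel C k q\<close>: the arrow \<open>q\<close> is a cokernel of \<open>k\<close>.\<close>

definition kernel :: "('o, 'a) cat \<Rightarrow> 'a \<Rightarrow> 'a \<Rightarrow> bool" where
  "kernel C q k \<longleftrightarrow>
    q \<in> Arr C \<and> k \<in> Arr C \<and> Cod C k = Dom C q \<and> zero_arrow C (q \<cdot>\<^bsub>C\<^esub> k) \<and>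
    (\<forall>t \<in> Arr C. Cod C t = Dom C q \<longrightarrow> zero_arrow C (q \<cdot>\<^bsub>C\<^esub> t) \<longrightarrow>
      (\<exists>!h. h \<in> hom C (Dom C t) (Dom C k) \<and> k \<cdot>\<^bsub>C\<^esub> h = t))"

definition cokernel :: "('o, 'a) cat \<Rightarrow> 'a \<Rightarrow> 'a \<Rightarrow> bool" where
  "cokernel C k q \<longleftrightarrow>
    k \<in> Arr C \<and> q \<in> Arr C \<and> Dom C q = Cod C k \<and> zero_arrow C (q \<cdot>\<^bsub>C\<^esub> k) \<and>
    (\<forall>t \<in> Arr C. Dom C t = Cod C k \<longrightarrow> zero_arrow C (t \<cdot>\<^bsub>C\<^esub> k) \<longrightarrow>
      (\<exists>!h. h \<in> hom C (Cod C q) (Cod C t) \<and> h \<cdot>\<^bsub>C\<^esub> q = t))"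


subsection \<open>Limits and colimits\<close>

text \<open>
  \<open>pullback C f g p q\<close>: the span \<open>(p, q)\<close> is a pullback of the cospan \<open>(f, g)\<close>, where
  \<open>f \<cdot> p = g \<cdot> q\<close>; thus \<open>q\<close> is a pullback of \<open>f\<close> along \<open>g\<close>.
\<close>

definition pullback :: "('o, 'a) cat \<Rightarrow> 'a \<Rightarrow> 'a \<Rightarrow> 'a \<Rightarrow> 'a \<Rightarrow> bool" where
  "pullback C f g p q \<longleftrightarrow>
    f \<in> Arr C \<and> g \<in> Arr C \<and> Cod C f = Cod C g \<and>
    p \<in> Arr C \<and> q \<in> Arr C \<and> Dom C p = Dom C q \<and> Cod C p = Dom C f \<and> Cod C q = Dom C g \<and>
    f \<cdot>\<^bsub>C\<^esub> p = g \<cdot>\<^bsub>C\<^esub> q \<and>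
    (\<forall>T. \<forall>u \<in> hom C T (Dom C f). \<forall>v \<in> hom C T (Dom C g). f \<cdot>\<^bsub>C\<^esub> u = g \<cdot>\<^bsub>C\<^esub> v \<longrightarrow>
      (\<exists>!h. h \<in> hom C T (Dom C p) \<and> p \<cdot>\<^bsub>C\<^esub> h = u \<and> q \<cdot>\<^bsub>C\<^esub> h = v))"

definition kernel_pair :: "('o, 'a) cat \<Rightarrow> 'a \<Rightarrow> 'a \<Rightarrow> 'a \<Rightarrow> bool" where
  "kernel_pair C f p q \<longleftrightarrow> pullback C f f p q"

definition finitely_complete :: "('o, 'a) cat \<Rightarrow> bool" where
  "finitely_complete C \<longleftrightarrow> (\<exists>Z. terminal C Z) \<and>
    (\<forall>f \<in> Arr C. \<forall>g \<in> Arr C. Cod C f = Cod C g \<longrightarrow> (\<exists>p q. pullback C f g p q))"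

definition coequalizer :: "('o, 'a) cat \<Rightarrow> 'a \<Rightarrow> 'a \<Rightarrow> 'a \<Rightarrow> bool" where
  "coequalizer C u v e \<longleftrightarrow>
    u \<in> Arr C \<and> v \<in> Arr C \<and> Dom C u = Dom C v \<and> Cod C u = Cod C v \<and>
    e \<in> Arr C \<and> Dom C e = Cod C u \<and> e \<cdot>\<^bsub>C\<^esub> u = e \<cdot>\<^bsub>C\<^esub> v \<and>
    (\<forall>t \<in> Arr C. Dom C t = Cod C u \<longrightarrow> t \<cdot>\<^bsub>C\<^esub> u = t \<cdot>\<^bsub>C\<^esub> v \<longrightarrow>
      (\<exists>!h. h \<in> hom C (Cod C e) (Cod C t) \<and> h \<cdot>\<^bsub>C\<^esub> e = t))"

definition regular_epi :: "('o, 'a) cat \<Rightarrow> 'a \<Rightarrow> bool" where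
  "regular_epi C e \<longleftrightarrow> (\<exists>u v. coequalizer C u v e)"

definition coproduct :: "('o, 'a) cat \<Rightarrow> 'o \<Rightarrow> 'o \<Rightarrow> 'a \<Rightarrow> 'a \<Rightarrow> bool" where
  "coproduct C A B i j \<longleftrightarrow>
    i \<in> Arr C \<and> j \<in> Arr C \<and> Dom C i = A \<and> Dom C j = B \<and> Cod C i = Cod C j \<and>
    (\<forall>T. \<forall>u \<in> hom C A T. \<forall>v \<in> hom C B T.
      (\<exists>!h. h \<in> hom C (Cod C i) T \<and> h \<cdot>\<^bsub>C\<^esub> i = u \<and> h \<cdot>\<^bsub>C\<^esub> j = v))"

definition has_finite_coproducts :: "('o, 'a) cat \<Rightarrow> bool" where
  "has_finite_coproducts C \<longleftrightarrow> (\<exists>Z. initial C Z) \<and>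
    (\<forall>A \<in> Obj C. \<forall>B \<in> Obj C. \<exists>i j. coproduct C A B i j)"


subsection \<open>Semi-abelian categories\<close>

definition regular_category :: "('o, 'a) cat \<Rightarrow> bool" where
  "regular_category C \<longleftrightarrow> finitely_complete C \<and>
    (\<forall>f p q. kernel_pair C f p q \<longrightarrow> (\<exists>e. coequalizer C p q e)) \<and>
    (\<forall>f g p q. pullback C f g p q \<longrightarrow> regular_epi C f \<longrightarrow> regular_epi C q)"

text \<open>
  Internal equivalence relations \<open>r, s : R \<rightarrow> X\<close>: jointly monic, reflexive, symmetric and transitive,
  where transitivity concerns the object of composable pairs, the pullback of \<open>s\<close> and \<open>r\<close>.
\<close>

definition equivalence_relation :: "('o, 'a) cat \<Rightarrow> 'a \<Rightarrow> 'a \<Rightarrow> bool" where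
  "equivalence_relation C r s \<longleftrightarrow>
    r \<in> Arr C \<and> s \<in> Arr C \<and> Dom C r = Dom C s \<and> Cod C r = Cod C s \<and>
    (\<forall>T. \<forall>u \<in> hom C T (Dom C r). \<forall>v \<in> hom C T (Dom C r).
      r \<cdot>\<^bsub>C\<^esub> u = r \<cdot>\<^bsub>C\<^esub> v \<longrightarrow> s \<cdot>\<^bsub>C\<^esub> u = s \<cdot>\<^bsub>C\<^esub> v \<longrightarrow> u = v) \<and>
    (\<exists>d \<in> hom C (Cod C r) (Dom C r).
      r \<cdot>\<^bsub>C\<^esub> d = Id C (Cod C r) \<and> s \<cdot>\<^bsub>C\<^esub> d = Id C (Cod C r)) \<and>
    (\<exists>c \<in> hom C (Dom C r) (Dom C r). r \<cdot>\<^bsub>C\<^esub> c = s \<and> s \<cdot>\<^bsub>C\<^esub> c = r) \<and>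
    (\<forall>p q. pullback C s r p q \<longrightarrow>
      (\<exists>t \<in> hom C (Dom C p) (Dom C r).
        r \<cdot>\<^bsub>C\<^esub> t = r \<cdot>\<^bsub>C\<^esub> p \<and> s \<cdot>\<^bsub>C\<^esub> t = s \<cdot>\<^bsub>C\<^esub> q))"

definition barr_exact :: "('o, 'a) cat \<Rightarrow> bool" where
  "barr_exact C \<longleftrightarrow> regular_category C \<and>
    (\<forall>r s. equivalence_relation C r s \<longrightarrow> (\<exists>f. kernel_pair C f r s))"

text \<open>
  \<open>point C B f s\<close>: \<open>(f, s)\<close> is a point over \<open>B\<close>, i.e. \<open>f\<close> is a split epimorphism with codomain
  \<open>B\<close> and chosen section \<open>s\<close>. A morphism of points \<open>(f, s) \<rightarrow> (f', s')\<close> is an arrow \<open>h\<close> with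
  \<open>f' \<cdot> h = f\<close> and \<open>h \<cdot> s = s'\<close>; it is invertible in the category of points precisely when
  \<open>h\<close> is invertible in \<open>C\<close>.
\<close>

definition point :: "('o, 'a) cat \<Rightarrow> 'o \<Rightarrow> 'a \<Rightarrow> 'a \<Rightarrow> bool" where
  "point C B f s \<longleftrightarrow>
    f \<in> Arr C \<and> Cod C f = B \<and> s \<in> hom C B (Dom C f) \<and> f \<cdot>\<^bsub>C\<^esub> s = Id C B"

definition point_morphism :: "('o, 'a) cat \<Rightarrow> 'a \<Rightarrow> 'a \<Rightarrow> 'a \<Rightarrow> 'a \<Rightarrow> 'a \<Rightarrow> bool" where
  "point_morphism C f s f' s' h \<longleftrightarrow>
    h \<in> hom C (Dom C f) (Dom C f') \<and> f' \<cdot>\<^bsub>C\<^esub> h = f \<and> h \<cdot>\<^bsub>C\<^esub> s = s'"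

text \<open>
  Bourn protomodularity: pullbacks of split epimorphisms exist, and for every \<open>b : E \<rightarrow> B\<close> the
  change-of-base functor along \<open>b\<close>, from points over \<open>B\<close> to points over \<open>E\<close>, reflects isomorphisms.
  Below, \<open>(e, x)\<close> and \<open>(e', x')\<close> are pullbacks of \<open>(b, f)\<close> and \<open>(b, f')\<close>, so that \<open>e\<close> and \<open>e'\<close>
  underlie the base changes of the points \<open>(f, s)\<close> and \<open>(f', s')\<close>, and \<open>h'\<close> is the base change of
  \<open>h\<close>, i.e. the unique arrow induced by \<open>h\<close> between these pullbacks.
\<close>

definition protomodular :: "('o, 'a) cat \<Rightarrow> bool" where
  "protomodular C \<longleftrightarrow>
    (\<forall>b \<in> Arr C. \<forall>f s. point C (Cod C b) f s \<longrightarrow> (\<exists>e x. pullback C b f e x)) \<and>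
    (\<forall>b \<in> Arr C. \<forall>f s f' s' h e x e' x' h'.
      point C (Cod C b) f s \<longrightarrow> point C (Cod C b) f' s' \<longrightarrow> point_morphism C f s f' s' h \<longrightarrow>
      pullback C b f e x \<longrightarrow> pullback C b f' e' x' \<longrightarrow>
      h' \<in> hom C (Dom C e) (Dom C e') \<longrightarrow> e' \<cdot>\<^bsub>C\<^esub> h' = e \<longrightarrow> x' \<cdot>\<^bsub>C\<^esub> h' = h \<cdot>\<^bsub>C\<^esub> x \<longrightarrow>
      iso C h' \<longrightarrow> iso C h)"

definition semi_abelian :: "('o, 'a) cat \<Rightarrow> bool" where
  "semi_abelian C \<longleftrightarrow> category C \<and> pointed C \<and> barr_exact C \<and> protomodular C \<and>
    has_finite_coproducts C"


section \<open>One-step extensions\<close>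

definition short_exact_sequences :: "('o, 'a) cat \<Rightarrow> 'o \<Rightarrow> 'o \<Rightarrow> ('a \<times> 'a) set" where
  "short_exact_sequences C K Q =
    {(k, q). Dom C k = K \<and> Cod C q = Q \<and> kernel C q k \<and> cokernel C k q}"

text \<open>
  An arrow of the category of extensions is an arrow \<open>\<xi>\<close> of \<open>C\<close> between the middle objects, tagged
  with the short exact sequences that are its domain and codomain.
\<close>

definition ext1_category ::
  "('o, 'a) cat \<Rightarrow> 'o \<Rightarrow> 'o \<Rightarrow> ('a \<times> 'a, ('a \<times> 'a) \<times> 'a \<times> ('a \<times> 'a)) cat" where
  "ext1_category C Q K =
    \<lparr>Obj = short_exact_sequences C K Q,
     Arr = {((k, q), \<xi>, (k', q')).
        (k, q) \<in> short_exact_sequences C K Q \<and> (k', q') \<in> short_exact_sequences C K Q \<and>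
        \<xi> \<in> hom C (Cod C k) (Cod C k') \<and> \<xi> \<cdot>\<^bsub>C\<^esub> k = k' \<and> q' \<cdot>\<^bsub>C\<^esub> \<xi> = q},
     Dom = (\<lambda>(E, \<xi>, E'). E),
     Cod = (\<lambda>(E, \<xi>, E'). E'),
     Id = (\<lambda>(k, q). ((k, q), Id C (Cod C k), (k, q))),
     Comp = (\<lambda>(E', \<xi>', E'') (E, \<xi>, E'). (E, \<xi>' \<cdot>\<^bsub>C\<^esub> \<xi>, E''))\<rparr>"

definition Ext1 :: "('o, 'a) cat \<Rightarrow> 'o \<Rightarrow> 'o \<Rightarrow> ('a \<times> 'a) set set" where
  "Ext1 C Q K = connected_components (ext1_category C Q K)"


section \<open>Varieties of algebras\<close>

datatype 'f trm = Var nat | App 'f "'f trm list"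

record 'u variety =
  symbols :: 'u
  arity :: "'u \<Rightarrow> nat"
  identities :: "('u trm \<times> 'u trm) set"

record 'u algebra =
  carrier :: 'u
  interp :: "'u \<Rightarrow> 'u list \<Rightarrow> 'u"

primrec wf_trm :: "('u \<Rightarrow> 'u set) \<Rightarrow> 'u variety \<Rightarrow> 'u trm \<Rightarrow> bool" where
  "wf_trm elts V (Var n) \<longleftrightarrow> True"
| "wf_trm elts V (App f ts) \<longleftrightarrow>
    f \<in> elts (symbols V) \<and> length ts = arity V f \<and> list_all (wf_trm elts V) ts"

primrec eval_trm :: "'u algebra \<Rightarrow> (nat \<Rightarrow> 'u) \<Rightarrow> 'u trm \<Rightarrow> 'u" where
  "eval_trm A v (Var n) = v n"
| "eval_trm A v (App f ts) = interp A f (map (eval_trm A v) ts)"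

definition is_variety :: "('u \<Rightarrow> 'u set) \<Rightarrow> 'u variety \<Rightarrow> bool" where
  "is_variety elts V \<longleftrightarrow> (\<forall>(t, t') \<in> identities V. wf_trm elts V t \<and> wf_trm elts V t')"

text \<open>The argument lists on which the operation symbol \<open>f\<close> is to be interpreted in \<open>A\<close>.\<close>

definition arguments :: "('u \<Rightarrow> 'u set) \<Rightarrow> 'u variety \<Rightarrow> 'u algebra \<Rightarrow> 'u \<Rightarrow> 'u list set" where
  "arguments elts V A f = {as. length as = arity V f \<and> set as \<subseteq> elts (carrier A)}"

text \<open>
  Interpretations are required to be \<open>undefined\<close> off their domains, so that two algebras are equal as
  soon as they have the same carrier and the same operations; similarly for homomorphisms below.
\<close>

definition algebra_of :: "('u \<Rightarrow> 'u set) \<Rightarrow> 'u variety \<Rightarrow> 'u algebra \<Rightarrow> bool" where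
  "algebra_of elts V A \<longleftrightarrow>
    (\<forall>f \<in> elts (symbols V). interp A f \<in> arguments elts V A f \<rightarrow>\<^sub>E elts (carrier A)) \<and>
    (\<forall>f. f \<notin> elts (symbols V) \<longrightarrow> interp A f = (\<lambda>_. undefined)) \<and>
    (\<forall>(t, t') \<in> identities V. \<forall>v. range v \<subseteq> elts (carrier A) \<longrightarrow>
      eval_trm A v t = eval_trm A v t')"

definition homomorphism ::
  "('u \<Rightarrow> 'u set) \<Rightarrow> 'u variety \<Rightarrow> 'u algebra \<Rightarrow> 'u algebra \<Rightarrow> ('u \<Rightarrow> 'u) \<Rightarrow> bool" where
  "homomorphism elts V A B \<phi> \<longleftrightarrow>
    \<phi> \<in> elts (carrier A) \<rightarrow>\<^sub>E elts (carrier B) \<and>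
    (\<forall>f \<in> elts (symbols V). \<forall>as \<in> arguments elts V A f.
      \<phi> (interp A f as) = interp B f (map \<phi> as))"

definition algebra_category ::
  "('u \<Rightarrow> 'u set) \<Rightarrow> 'u variety \<Rightarrow> ('u algebra, 'u algebra \<times> ('u \<Rightarrow> 'u) \<times> 'u algebra) cat" where
  "algebra_category elts V =
    \<lparr>Obj = {A. algebra_of elts V A},
     Arr = {(A, \<phi>, B). algebra_of elts V A \<and> algebra_of elts V B \<and> homomorphism elts V A B \<phi>},
     Dom = (\<lambda>(A, \<phi>, B). A),
     Cod = (\<lambda>(A, \<phi>, B). B),
     Id = (\<lambda>A. (A, restrict id (elts (carrier A)), A)),
     Comp = (\<lambda>(B, \<psi>, D) (A, \<phi>, B'). (A, compose (elts (carrier A)) \<psi> \<phi>, D))\<rparr>"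

lemma category_algebra_category: "category (algebra_category elts V)"
proof -
  have id: "homomorphism elts V A A (restrict id (elts (carrier A)))"
    if "algebra_of elts V A" for A :: "'a algebra"
  proof -
    have "map (restrict id (elts (carrier A))) as = as" if "set as \<subseteq> elts (carrier A)" for as
      using that by (intro map_idI) auto
    moreover have "interp A f as \<in> elts (carrier A)"
      if "f \<in> elts (symbols V)" "as \<in> arguments elts V A f" for f as
      using that \<open>algebra_of elts V A\<close> unfolding algebra_of_def by blast
    ultimately show ?thesis
      by (auto simp: homomorphism_def arguments_def)
  qed
  have comp: "homomorphism elts V A D (compose (elts (carrier A)) \<psi> \<phi>)"
    if A: "algebra_of elts V A" and \<phi>: "homomorphism elts V A B \<phi>"
      and \<psi>: "homomorphism elts V B D \<psi>" for A B D :: "'a algebra" and \<phi> \<psi>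
    unfolding homomorphism_def
  proof (intro conjI ballI)
    show "compose (elts (carrier A)) \<psi> \<phi> \<in> elts (carrier A) \<rightarrow>\<^sub>E elts (carrier D)"
      using \<phi> \<psi> by (auto simp: homomorphism_def compose_def)
  next
    fix f as assume f: "f \<in> elts (symbols V)" and as: "as \<in> arguments elts V A f"
    have "interp A f as \<in> elts (carrier A)"
      using A f as unfolding algebra_of_def by blast
    moreover have "map \<phi> as \<in> arguments elts V B f"
      using \<phi> as by (auto simp: homomorphism_def arguments_def)
    moreover have "map (compose (elts (carrier A)) \<psi> \<phi>) as = map \<psi> (map \<phi> as)"
      using as by (auto simp: arguments_def compose_def)
    moreover have "\<phi> (interp A f as) = interp B f (map \<phi> as)"
      using \<phi> f as by (simp add: homomorphism_def)
    moreover have "\<psi> (interp B f (map \<phi> as)) = interp D f (map \<psi> (map \<phi> as))"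
      using \<psi> f \<open>map \<phi> as \<in> arguments elts V B f\<close> unfolding homomorphism_def by blast
    ultimately show "compose (elts (carrier A)) \<psi> \<phi> (interp A f as) =
        interp D f (map (compose (elts (carrier A)) \<psi> \<phi>) as)"
      by (simp only: compose_eq)
  qed
  show ?thesis
  proof
    fix f g h and A B D E :: "'a algebra"
    assume "f \<in> hom (algebra_category elts V) A B"
      and "g \<in> hom (algebra_category elts V) B D"
      and "h \<in> hom (algebra_category elts V) D E"
    then show "h \<cdot>\<^bsub>algebra_category elts V\<^esub> (g \<cdot>\<^bsub>algebra_category elts V\<^esub> f) =
        h \<cdot>\<^bsub>algebra_category elts V\<^esub> g \<cdot>\<^bsub>algebra_category elts V\<^esub> f"
      by (auto simp: hom_def algebra_category_def homomorphism_def compose_def fun_eq_iff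
          restrict_def PiE_mem)
  next
    fix f and A B :: "'a algebra"
    assume f: "f \<in> hom (algebra_category elts V) A B"
    then show "f \<cdot>\<^bsub>algebra_category elts V\<^esub> Id (algebra_category elts V) A = f"
      by (auto simp: hom_def algebra_category_def homomorphism_def compose_def fun_eq_iff
          restrict_def PiE_def extensional_def)
    show "Id (algebra_category elts V) B \<cdot>\<^bsub>algebra_category elts V\<^esub> f = f"
      using f by (auto simp: hom_def algebra_category_def homomorphism_def compose_def fun_eq_iff
          restrict_def PiE_def extensional_def)
  qed (auto simp: hom_def algebra_category_def intro: id comp)
qed

definition semi_abelian_variety :: "('u \<Rightarrow> 'u set) \<Rightarrow> 'u variety \<Rightarrow> bool" where
  "semi_abelian_variety elts V \<longleftrightarrow> is_variety elts V \<and> semi_abelian (algebra_category elts V)"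

end

theory Submission
  imports Defs
begin

text \<open>
  Let \<open>0 \<rightarrow> K \<rightarrow> X \<rightarrow> Q \<rightarrow> 0\<close> be a short exact sequence in a variety whose category is pointed and
  protomodular, and choose a preimage in \<open>X\<close> of every element of \<open>Q\<close>. The subalgebra generated by
  \<open>K\<close> and these preimages has the same kernel and the same quotient as \<open>X\<close>, so it is \<open>X\<close> by the short
  five lemma (\<open>subalgebra_over_exact_sequence\<close>), which is what protomodularity provides.

  Hence every element of \<open>X\<close> is the value of a term in generators indexed by the disjoint union of
  \<open>K\<close> and \<open>Q\<close> (\<open>exact_sequence_generated\<close>). The extension is then determined up to isomorphism by the
  set of pairs of terms with equal values (\<open>morphism_of_term_equations\<close>). Operations are finitary and
  the operation symbols form a set, so the terms form a small conglomerate \<open>T\<close> (\<open>small_terms\<close>),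
  and the components of extensions are an image of a part of the power set of \<open>T \<times> T\<close>, which is small.

  The remaining work is elementwise: the kernels and cokernels of the category are identified with
  injections onto the fibre of \<open>0\<close> and with surjections (\<open>short_exact_sequence_elements\<close>).
\<close>

section \<open>Small conglomerates\<close>

context grothendieck_universe
begin

lemma separation:
  assumes "S \<subseteq> elts u"
  shows "\<exists>v. elts v = S"
proof -
  obtain p where "elts ` elts p = Pow (elts u)"
    using power_set by blast
  with assms have "S \<in> elts ` elts p" by simp
  then show ?thesis by blast
qed

lemma replacement: "\<exists>v. elts v = f ` elts u"
proof -
  have "\<forall>y. \<exists>z. elts z = {f y}"
    using pairing[of "f y" "f y" for y] by simp
  then obtain F where "\<forall>y. elts (F y) = {f y}" by metis
  moreover obtain v where "elts v = (\<Union>y\<in>elts u. elts (F y))"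
    using union by blast
  ultimately have "elts v = f ` elts u" by auto
  then show ?thesis ..
qed

lemma small_iff_subset_image: "small elts S \<longleftrightarrow> (\<exists>u f. S \<subseteq> f ` elts u)"
proof
  assume "small elts S"
  then obtain u f where "bij_betw f S (elts u)" by (auto simp: small_def)
  then have "S \<subseteq> inv_into S f ` elts u"
    using bij_betw_inv_into bij_betw_imp_surj_on by blast
  then show "\<exists>u f. S \<subseteq> f ` elts u" by blast
next
  assume "\<exists>u f. S \<subseteq> f ` elts u"
  then obtain u f where S: "S \<subseteq> f ` elts u" by blast
  let ?g = "inv_into (elts u) f"
  have "?g ` S \<subseteq> elts u" using S by (auto intro: inv_into_into)
  then obtain v where "elts v = ?g ` S" using separation by blast
  moreover have "inj_on ?g S" using S by (rule inj_on_inv_into)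
  ultimately show "small elts S"
    unfolding small_def bij_betw_def by blast
qed

lemma small_covered: "S \<subseteq> f ` elts u \<Longrightarrow> small elts S"
  using small_iff_subset_image[of S] by blast

lemma small_cover:
  assumes "small elts S"
  obtains u f where "S \<subseteq> f ` elts u"
  using assms small_iff_subset_image[of S] by blast

lemma small_elts [simp]: "small elts (elts u)"
  unfolding small_def by (blast intro: bij_betw_id)

lemma small_subset:
  assumes "small elts T" and "S \<subseteq> T"
  shows "small elts S"
proof -
  obtain u f where "T \<subseteq> f ` elts u" using assms(1) by (rule small_cover)
  with assms(2) have "S \<subseteq> f ` elts u" by simp
  then show ?thesis by (rule small_covered)
qed

lemma small_image:
  assumes "small elts S"
  shows "small elts (h ` S)"
proof -
  obtain u f where "S \<subseteq> f ` elts u"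
    using assms by (rule small_cover)
  then have "h ` S \<subseteq> (h \<circ> f) ` elts u" by auto
  then show ?thesis by (rule small_covered)
qed

text \<open>The witness is Kuratowski's pair \<open>{{a}, {a, b}}\<close>.\<close>

lemma ordered_pairs: "\<exists>c :: 'u \<times> 'u \<Rightarrow> 'u. inj c"
proof -
  define d where "d x y = (SOME z. elts z = {x, y})" for x y
  have d: "elts (d x y) = {x, y}" for x y
    unfolding d_def using pairing[of x y] by (rule someI_ex)
  have d_eq: "{x, y} = {x', y'}" if "d x y = d x' y'" for x y x' y'
    using d[of x y] d[of x' y'] that by simp
  have "inj (\<lambda>(x, y). d (d x x) (d x y))"
  proof (rule injI, clarify)
    fix a b a' b'
    assume "d (d a a) (d a b) = d (d a' a') (d a' b')"
    then have "{d a a, d a b} = {d a' a', d a' b'}" by (rule d_eq)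
    then consider "d a a = d a' a'" "d a b = d a' b'" | "d a a = d a' b'" "d a b = d a' a'"
      unfolding doubleton_eq_iff by blast
    then show "a = a' \<and> b = b'"
    proof cases
      case 1
      then show ?thesis using d_eq[OF 1(1)] d_eq[OF 1(2)] unfolding doubleton_eq_iff by blast
    next
      case 2
      then show ?thesis using d_eq[OF 2(1)] d_eq[OF 2(2)] unfolding doubleton_eq_iff by blast
    qed
  qed
  then show ?thesis by blast
qed

text \<open>
  The union axiom is applied to sets of coded pairs of an index and an element, which keep track of
  the index whose parametrization is to be used.
\<close>

lemma small_UN:
  assumes "small elts I" and "\<And>i. i \<in> I \<Longrightarrow> small elts (B i)"
  shows "small elts (\<Union>i\<in>I. B i)"
proof -
  obtain a f where f: "I \<subseteq> f ` elts a"
    using assms(1) by (rule small_cover)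
  have "\<forall>i\<in>I. \<exists>u h. B i \<subseteq> h ` elts u"
    using assms(2) small_iff_subset_image[of "B i" for i] by simp
  then obtain b g where g: "\<And>i. i \<in> I \<Longrightarrow> B i \<subseteq> g i ` elts (b i)" by metis
  obtain c :: "'u \<times> 'u \<Rightarrow> 'u" where c: "inj c" using ordered_pairs by blast
  have "\<forall>x. \<exists>z. elts z = (\<lambda>y. c (x, y)) ` elts (b (f x))"
    using replacement by blast
  then obtain F where F: "\<And>x. elts (F x) = (\<lambda>y. c (x, y)) ` elts (b (f x))" by metis
  obtain d where d: "elts d = (\<Union>x\<in>elts a. elts (F x))" using union by blast
  let ?h = "\<lambda>w. case inv c w of (x, y) \<Rightarrow> g (f x) y"
  have "(\<Union>i\<in>I. B i) \<subseteq> ?h ` elts d"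
  proof clarify
    fix i z assume i: "i \<in> I" and z: "z \<in> B i"
    obtain x where x: "x \<in> elts a" "i = f x" using f i by blast
    obtain y where y: "y \<in> elts (b i)" "z = g i y" using g[OF i] z by blast
    have "c (x, y) \<in> elts d" using x y by (auto simp: d F)
    moreover have "?h (c (x, y)) = z" using x y c by simp
    ultimately show "z \<in> ?h ` elts d" by force
  qed
  then show ?thesis by (rule small_covered)
qed

lemma small_Times:
  assumes "small elts S" and "small elts T"
  shows "small elts (S \<times> T)"
proof -
  have "S \<times> T = (\<Union>x\<in>S. Pair x ` T)" by auto
  then show ?thesis using assms by (simp add: small_UN small_image)
qed

lemma small_Pow:
  assumes "small elts S"
  shows "small elts (Pow S)"
proof -
  obtain u f where "S \<subseteq> f ` elts u"
    using assms by (rule small_cover)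
  then have "Pow S \<subseteq> (`) f ` Pow (elts u)"
    unfolding image_Pow_surj[OF refl] by (rule Pow_mono)
  moreover obtain p where "elts ` elts p = Pow (elts u)" using power_set by blast
  ultimately have "Pow S \<subseteq> (\<lambda>x. f ` elts x) ` elts p"
    by (metis image_image)
  then show ?thesis by (rule small_covered)
qed

lemma small_Un:
  assumes "small elts S" and "small elts T"
  shows "small elts (S \<union> T)"
proof -
  obtain x y p where p: "elts p = {x, y :: 'u}" "x \<noteq> y"
  proof -
    obtain e where e: "elts e = {}" using separation by blast
    obtain s where s: "elts s = {e}" using pairing[of e e] by auto
    have "e \<noteq> s" using e s by auto
    then show ?thesis using pairing[of e s] that by metis
  qed
  have "small elts (\<Union>i\<in>elts p. if i = x then S else T)"
    using assms by (intro small_UN) auto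
  then show ?thesis using p by (simp add: Un_commute)
qed

text \<open>
  Iterated successors inside the set given by the axiom of infinity form a copy of the natural
  numbers: a smaller number belongs to every larger one, and by foundation no set belongs to
  itself, so the iterates are distinct.
\<close>

lemma small_nat: "small elts (UNIV :: nat set)"
proof -
  obtain w z where z: "z \<in> elts w"
    and suc: "\<forall>x\<in>elts w. \<exists>y\<in>elts w. elts y = insert x (elts x)"
    using infinity by blast
  obtain s where s: "\<And>x. x \<in> elts w \<Longrightarrow> s x \<in> elts w \<and> elts (s x) = insert x (elts x)"
    using suc by metis
  define N where "N n = (s ^^ n) z" for n
  have N: "N n \<in> elts w" for n
    by (induction n) (auto simp: N_def z s)
  have lt: "N m \<in> elts (N n)" if "m < n" for m n
    using that
  proof (induction n)
    case (Suc n)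
    have "elts (N (Suc n)) = insert (N n) (elts (N n))"
      using s[OF N[of n]] by (simp add: N_def)
    then show ?case using Suc by (auto simp: less_Suc_eq)
  qed simp
  have irrefl: "x \<notin> elts x" for x
    using foundation by (auto dest: wf_not_refl)
  have "inj N"
    by (rule linorder_injI) (metis lt irrefl)
  then have "(UNIV :: nat set) \<subseteq> inv N ` elts w"
    using N by (metis inv_f_f image_eqI subsetI)
  then show ?thesis by (rule small_covered)
qed

lemma small_lists:
  assumes "small elts S"
  shows "small elts (lists S)"
proof -
  have "small elts {xs \<in> lists S. length xs = n}" for n
  proof (induction n)
    case 0
    obtain w where "elts w \<noteq> {}" using infinity by blast
    then have "{xs \<in> lists S. length xs = 0} \<subseteq> (\<lambda>_. []) ` elts w" by auto
    then show ?case by (rule small_covered)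
  next
    case (Suc n)
    have "{xs \<in> lists S. length xs = Suc n} \<subseteq>
        (\<lambda>(x, xs). x # xs) ` (S \<times> {xs \<in> lists S. length xs = n})"
      by (auto simp: length_Suc_conv image_iff)
    then show ?case
      by (rule small_subset[rotated]) (intro small_image small_Times assms Suc)
  qed
  then have "small elts (\<Union>n. {xs \<in> lists S. length xs = n})"
    using small_nat by (intro small_UN) auto
  moreover have "lists S \<subseteq> (\<Union>n. {xs \<in> lists S. length xs = n})" by auto
  ultimately show ?thesis by (rule small_subset)
qed

end


section \<open>Terms in generators\<close>

text \<open>
  Generators from an arbitrary type take the place of the variables \<open>Var n\<close>, since \<open>K\<close> and \<open>Q\<close> may
  have more than countably many elements.
\<close>

datatype ('f, 'g) gen_trm = Gen 'g | Op 'f "('f, 'g) gen_trm list"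

inductive_set terms :: "'f set \<Rightarrow> ('f \<Rightarrow> nat) \<Rightarrow> 'g set \<Rightarrow> ('f, 'g) gen_trm set"
  for F :: "'f set" and ar :: "'f \<Rightarrow> nat" and G :: "'g set" where
  Gen: "g \<in> G \<Longrightarrow> Gen g \<in> terms F ar G"
| Op: "f \<in> F \<Longrightarrow> length ts = ar f \<Longrightarrow> \<forall>t\<in>set ts. t \<in> terms F ar G \<Longrightarrow> Op f ts \<in> terms F ar G"

primrec gen_eval :: "'u algebra \<Rightarrow> ('g \<Rightarrow> 'u) \<Rightarrow> ('u, 'g) gen_trm \<Rightarrow> 'u" where
  "gen_eval A v (Gen g) = v g"
| "gen_eval A v (Op f ts) = interp A f (map (gen_eval A v) ts)"

text \<open>
  Because operations are finitary, the terms are exhausted by countably many stages according to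
  their height, and each stage is built from finite lists of terms of the previous stage.
\<close>

lemma (in grothendieck_universe) small_terms:
  assumes "small elts F" and "small elts G"
  shows "small elts (terms F ar G)"
proof -
  define L where "L = rec_nat {} (\<lambda>_ T. Gen ` G \<union> (\<lambda>(f, ts). Op f ts) ` (F \<times> lists T))"
  have L0: "L 0 = {}"
    and LSuc: "L (Suc n) = Gen ` G \<union> (\<lambda>(f, ts). Op f ts) ` (F \<times> lists (L n))" for n
    by (simp_all add: L_def)
  have small_L: "small elts (L n)" for n
  proof (induction n)
    case 0
    show ?case unfolding L0 by (rule small_covered) (rule empty_subsetI)
  next
    case (Suc n)
    then show ?case
      by (simp add: LSuc assms small_Un small_image small_Times small_lists)
  qed
  have L_step: "L n \<subseteq> L (Suc n)" for n
  proof (induction n)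
    case (Suc n)
    then show ?case using lists_mono[OF Suc] by (subst (1 2) LSuc) blast
  qed (simp add: L0)
  have L_mono: "L m \<subseteq> L n" if "m \<le> n" for m n
    using lift_Suc_mono_le[of L, OF L_step that] .
  have "t \<in> (\<Union>n. L n)" if "t \<in> terms F ar G" for t
    using that
  proof induction
    case (Gen g)
    then have "Gen g \<in> L (Suc 0)" by (simp add: LSuc)
    then show ?case by blast
  next
    case (Op f ts)
    have "\<forall>t\<in>set ts. \<exists>n. t \<in> L n" using Op by blast
    then obtain n where n: "\<And>t. t \<in> set ts \<Longrightarrow> t \<in> L (n t)" by metis
    have "t \<in> L (Max (n ` set ts))" if "t \<in> set ts" for t
      using n[OF that] L_mono[of "n t" "Max (n ` set ts)"] that by auto
    then have "ts \<in> lists (L (Max (n ` set ts)))" by auto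
    then have "Op f ts \<in> L (Suc (Max (n ` set ts)))"
      using Op by (auto simp: LSuc)
    then show ?case by blast
  qed
  then have "terms F ar G \<subseteq> (\<Union>n. L n)" by blast
  moreover have "small elts (\<Union>n. L n)"
    using small_nat small_L by (intro small_UN)
  ultimately show ?thesis by (rule small_subset[rotated])
qed


section \<open>Algebras and algebra maps\<close>

locale variety_in_universe = grothendieck_universe elts
  for elts :: "'u \<Rightarrow> 'u set" +
  fixes V :: "'u variety"
  assumes is_variety: "is_variety elts V"
begin

abbreviation "U A \<equiv> elts (carrier A)"
abbreviation "alg \<equiv> algebra_of elts V"
abbreviation "\<V> \<equiv> algebra_category elts V"

definition algebra_map :: "'u algebra \<Rightarrow> 'u algebra \<Rightarrow> ('u \<Rightarrow> 'u) \<Rightarrow> bool" where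
  "algebra_map A B \<phi> \<longleftrightarrow> \<phi> ` U A \<subseteq> U B \<and>
    (\<forall>f\<in>elts (symbols V). \<forall>as\<in>arguments elts V A f.
      \<phi> (interp A f as) = interp B f (map \<phi> as))"

text \<open>
  Arrows of \<open>\<V>\<close> are extensional functions; this constructor restricts an arbitrary function to the
  domain, so that elementwise formulas can be used throughout.
\<close>

definition arr :: "'u algebra \<Rightarrow> 'u algebra \<Rightarrow> ('u \<Rightarrow> 'u) \<Rightarrow> 'u algebra \<times> ('u \<Rightarrow> 'u) \<times> 'u algebra" where
  "arr A B \<phi> = (A, restrict \<phi> (U A), B)"

lemma interp_closed:
  "alg A \<Longrightarrow> f \<in> elts (symbols V) \<Longrightarrow> as \<in> arguments elts V A f \<Longrightarrow> interp A f as \<in> U A"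
  unfolding algebra_of_def by blast

lemma algebra_mapD:
  assumes "algebra_map A B \<phi>"
  shows "x \<in> U A \<Longrightarrow> \<phi> x \<in> U B"
    and "f \<in> elts (symbols V) \<Longrightarrow> as \<in> arguments elts V A f \<Longrightarrow>
      \<phi> (interp A f as) = interp B f (map \<phi> as)"
  using assms unfolding algebra_map_def by blast+

lemma algebra_mapI:
  assumes "\<And>x. x \<in> U A \<Longrightarrow> \<phi> x \<in> U B"
    and "\<And>f as. f \<in> elts (symbols V) \<Longrightarrow> as \<in> arguments elts V A f \<Longrightarrow>
      \<phi> (interp A f as) = interp B f (map \<phi> as)"
  shows "algebra_map A B \<phi>"
  unfolding algebra_map_def image_subset_iff using assms by simp

lemma map_arguments:
  "algebra_map A B \<phi> \<Longrightarrow> as \<in> arguments elts V A f \<Longrightarrow> map \<phi> as \<in> arguments elts V B f"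
  unfolding algebra_map_def arguments_def by (auto simp: image_subset_iff)

lemma algebra_map_id: "algebra_map A A (\<lambda>x. x)"
  unfolding algebra_map_def by simp

lemma algebra_map_comp:
  assumes "algebra_map A B \<phi>" and "algebra_map B D \<psi>"
  shows "algebra_map A D (\<lambda>x. \<psi> (\<phi> x))"
proof -
  have "\<psi> (\<phi> (interp A f as)) = interp D f (map (\<lambda>x. \<psi> (\<phi> x)) as)"
    if "f \<in> elts (symbols V)" and "as \<in> arguments elts V A f" for f as
    using algebra_mapD(2)[OF assms(1) that]
      algebra_mapD(2)[OF assms(2) that(1) map_arguments[OF assms(1) that(2)]]
    by (simp add: comp_def)
  then show ?thesis
    using algebra_mapD(1)[OF assms(2) algebra_mapD(1)[OF assms(1)]] by (intro algebra_mapI)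
qed

lemma algebra_map_cong:
  assumes "alg A" and "\<And>x. x \<in> U A \<Longrightarrow> \<phi> x = \<psi> x" and "algebra_map A B \<phi>"
  shows "algebra_map A B \<psi>"
proof -
  have "\<psi> (interp A f as) = interp B f (map \<psi> as)"
    if "f \<in> elts (symbols V)" and "as \<in> arguments elts V A f" for f as
  proof -
    have "map \<phi> as = map \<psi> as"
      using that(2) assms(2) by (auto simp: arguments_def)
    then show ?thesis
      using algebra_mapD(2)[OF assms(3) that] assms(2)[OF interp_closed[OF assms(1) that]]
      by (simp del: map_eq_conv)
  qed
  moreover have "\<psi> x \<in> U B" if "x \<in> U A" for x
    using assms(2)[OF that] algebra_mapD(1)[OF assms(3) that] by simp
  ultimately show ?thesis by (intro algebra_mapI)
qed

lemma Obj_iff: "A \<in> Obj \<V> \<longleftrightarrow> alg A"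
  by (simp add: algebra_category_def)

lemma Dom_Cod_arr [simp]: "Dom \<V> (arr A B \<phi>) = A" "Cod \<V> (arr A B \<phi>) = B"
  by (simp_all add: algebra_category_def arr_def)

lemma Arr_iff:
  "f \<in> Arr \<V> \<longleftrightarrow> (\<exists>A B \<phi>. f = arr A B \<phi> \<and> alg A \<and> alg B \<and> algebra_map A B \<phi>)"
proof
  assume "f \<in> Arr \<V>"
  then obtain A \<phi> B where f: "f = (A, \<phi>, B)" "alg A" "alg B" "homomorphism elts V A B \<phi>"
    by (auto simp: algebra_category_def)
  then have "f = arr A B \<phi>" and "algebra_map A B \<phi>"
    by (auto simp: arr_def homomorphism_def algebra_map_def PiE_restrict)
  with f show "\<exists>A B \<phi>. f = arr A B \<phi> \<and> alg A \<and> alg B \<and> algebra_map A B \<phi>" by blast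
next
  assume "\<exists>A B \<phi>. f = arr A B \<phi> \<and> alg A \<and> alg B \<and> algebra_map A B \<phi>"
  then obtain A B \<phi> where f: "f = arr A B \<phi>" "alg A" "alg B" "algebra_map A B \<phi>" by blast
  have "algebra_map A B (restrict \<phi> (U A))"
    by (rule algebra_map_cong[OF f(2) _ f(4)]) simp
  then have "homomorphism elts V A B (restrict \<phi> (U A))"
    by (auto simp: homomorphism_def algebra_map_def image_subset_iff)
  with f show "f \<in> Arr \<V>"
    by (simp add: algebra_category_def arr_def)
qed

lemma hom_iff:
  "f \<in> hom \<V> A B \<longleftrightarrow> alg A \<and> alg B \<and> (\<exists>\<phi>. algebra_map A B \<phi> \<and> f = arr A B \<phi>)"
  unfolding hom_def mem_Collect_eq Arr_iff by auto

lemma arr_in_Arr: "alg A \<Longrightarrow> alg B \<Longrightarrow> algebra_map A B \<phi> \<Longrightarrow> arr A B \<phi> \<in> Arr \<V>"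
  unfolding Arr_iff by blast

lemma arr_in_hom: "alg A \<Longrightarrow> alg B \<Longrightarrow> algebra_map A B \<phi> \<Longrightarrow> arr A B \<phi> \<in> hom \<V> A B"
  unfolding hom_iff by blast

lemma arr_eq_iff:
  "arr A B \<phi> = arr A' B' \<psi> \<longleftrightarrow> A = A' \<and> B = B' \<and> (\<forall>x\<in>U A. \<phi> x = \<psi> x)"
  unfolding arr_def by (auto simp: fun_eq_iff restrict_def)

lemma Comp_arr:
  "algebra_map A B \<phi> \<Longrightarrow> arr B D \<psi> \<cdot>\<^bsub>\<V>\<^esub> arr A B \<phi> = arr A D (\<lambda>x. \<psi> (\<phi> x))"
  unfolding algebra_map_def
  by (auto simp: algebra_category_def arr_def compose_def fun_eq_iff restrict_def)

lemma Id_arr: "Id \<V> A = arr A A (\<lambda>x. x)"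
  by (simp add: algebra_category_def arr_def id_def)

lemma eval_trm_algebra_map:
  assumes "\<And>f as. f \<in> elts (symbols V) \<Longrightarrow> as \<in> arguments elts V A f \<Longrightarrow> interp A f as \<in> U A"
    and "algebra_map A B \<phi>" and "range v \<subseteq> U A"
  shows "wf_trm elts V t \<Longrightarrow>
    eval_trm A v t \<in> U A \<and> \<phi> (eval_trm A v t) = eval_trm B (\<lambda>n. \<phi> (v n)) t"
proof (induction t)
  case (Var n)
  then show ?case using assms(3) by auto
next
  case (App f ts)
  then have ts: "eval_trm A v t \<in> U A \<and> \<phi> (eval_trm A v t) = eval_trm B (\<lambda>n. \<phi> (v n)) t"
    if "t \<in> set ts" for t
    using that by (auto simp: list_all_iff)
  then have args: "map (eval_trm A v) ts \<in> arguments elts V A f"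
    using App.prems by (auto simp: arguments_def)
  have "map \<phi> (map (eval_trm A v) ts) = map (eval_trm B (\<lambda>n. \<phi> (v n))) ts"
    using ts by simp
  then show ?case
    using App.prems assms(1)[OF _ args] algebra_mapD(2)[OF assms(2) _ args]
    by (simp del: map_map map_eq_conv)
qed

text \<open>
  Identities are checked through a jointly injective family of maps, so such a family into algebras
  makes its domain an algebra as soon as the images are closed under the operations. Subalgebras,
  fibre products and the one-element algebra (via the empty family) are all instances.
\<close>

lemma initial_structure:
  assumes alg: "\<And>i. i \<in> I \<Longrightarrow> alg (A i)"
    and p: "\<And>i x. i \<in> I \<Longrightarrow> x \<in> elts u \<Longrightarrow> p i x \<in> U (A i)"
    and joint: "\<And>x y. x \<in> elts u \<Longrightarrow> y \<in> elts u \<Longrightarrow> (\<And>i. i \<in> I \<Longrightarrow> p i x = p i y) \<Longrightarrow> x = y"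
    and closed: "\<And>f xs. f \<in> elts (symbols V) \<Longrightarrow> length xs = arity V f \<Longrightarrow> set xs \<subseteq> elts u \<Longrightarrow>
      \<exists>x\<in>elts u. \<forall>i\<in>I. p i x = interp (A i) f (map (p i) xs)"
  obtains P where "alg P" and "carrier P = u" and "\<And>i. i \<in> I \<Longrightarrow> algebra_map P (A i) (p i)"
proof -
  define op where "op f xs =
    (SOME x. x \<in> elts u \<and> (\<forall>i\<in>I. p i x = interp (A i) f (map (p i) xs)))" for f xs
  define P where "P = \<lparr>carrier = u, interp = (\<lambda>f xs.
    if f \<in> elts (symbols V) \<and> length xs = arity V f \<and> set xs \<subseteq> elts u then op f xs else undefined)\<rparr>"
  have carrier: "carrier P = u" by (simp add: P_def)
  have op: "interp P f xs \<in> elts u \<and> (\<forall>i\<in>I. p i (interp P f xs) = interp (A i) f (map (p i) xs))"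
    if "f \<in> elts (symbols V)" and "xs \<in> arguments elts V P f" for f xs
  proof -
    have *: "length xs = arity V f" "set xs \<subseteq> elts u"
      using that(2) by (simp_all add: arguments_def carrier)
    have "\<exists>x. x \<in> elts u \<and> (\<forall>i\<in>I. p i x = interp (A i) f (map (p i) xs))"
      using closed[OF that(1) *] by blast
    then have "op f xs \<in> elts u \<and> (\<forall>i\<in>I. p i (op f xs) = interp (A i) f (map (p i) xs))"
      unfolding op_def by (rule someI_ex)
    then show ?thesis using that(1) * by (simp add: P_def)
  qed
  have maps: "algebra_map P (A i) (p i)" if "i \<in> I" for i
    using op p[OF that] that by (intro algebra_mapI) (simp_all add: carrier)
  have interp_P: "interp P f as \<in> U P"
    if "f \<in> elts (symbols V)" "as \<in> arguments elts V P f" for f as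
    using op[OF that] by (simp add: carrier)
  have identity: "eval_trm P v t = eval_trm P v t'"
    if t: "(t, t') \<in> identities V" and v: "range v \<subseteq> U P" for t t' v
  proof -
    have wf: "wf_trm elts V t" "wf_trm elts V t'"
      using is_variety t unfolding is_variety_def by blast+
    have "p i (eval_trm P v t) = p i (eval_trm P v t')" if i: "i \<in> I" for i
    proof -
      have "range (\<lambda>n. p i (v n)) \<subseteq> U (A i)"
        using v p[OF i] by (auto simp: carrier)
      then have "eval_trm (A i) (\<lambda>n. p i (v n)) t = eval_trm (A i) (\<lambda>n. p i (v n)) t'"
        using alg[OF i] t unfolding algebra_of_def by blast
      then show ?thesis
        using eval_trm_algebra_map[OF interp_P maps[OF i] v] wf by simp
    qed
    moreover have "eval_trm P v t \<in> elts u \<and> eval_trm P v t' \<in> elts u"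
      using eval_trm_algebra_map[OF interp_P algebra_map_id v] wf by (simp add: carrier)
    ultimately show ?thesis using joint by blast
  qed
  have "interp P f \<in> arguments elts V P f \<rightarrow>\<^sub>E U P" if "f \<in> elts (symbols V)" for f
  proof (rule PiE_I)
    show "interp P f as = undefined" if "as \<notin> arguments elts V P f" for as
      using that by (auto simp: P_def arguments_def)
  qed (rule interp_P[OF that])
  moreover have "interp P f = (\<lambda>_. undefined)" if "f \<notin> elts (symbols V)" for f
    using that by (simp add: P_def)
  ultimately have "alg P"
    unfolding algebra_of_def using identity by blast
  then show ?thesis using that carrier maps by blast
qed

text \<open>The universal property of such a structure: maps into it are detected by the family.\<close>

lemma algebra_map_lift:
  assumes "alg T" and "alg P"
    and maps: "\<And>i. i \<in> I \<Longrightarrow> algebra_map P (A i) (p i)"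
    and joint: "\<And>x y. x \<in> U P \<Longrightarrow> y \<in> U P \<Longrightarrow> (\<And>i. i \<in> I \<Longrightarrow> p i x = p i y) \<Longrightarrow> x = y"
    and \<phi>: "\<And>t. t \<in> U T \<Longrightarrow> \<phi> t \<in> U P"
    and lifts: "\<And>i. i \<in> I \<Longrightarrow> algebra_map T (A i) (\<lambda>t. p i (\<phi> t))"
  shows "algebra_map T P \<phi>"
proof -
  have "\<phi> (interp T f as) = interp P f (map \<phi> as)"
    if f: "f \<in> elts (symbols V)" and as: "as \<in> arguments elts V T f" for f as
  proof (rule joint)
    have args: "map \<phi> as \<in> arguments elts V P f"
      using as \<phi> by (auto simp: arguments_def)
    show "\<phi> (interp T f as) \<in> U P"
      using \<phi> interp_closed[OF \<open>alg T\<close> f as] by blast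
    show "interp P f (map \<phi> as) \<in> U P"
      using interp_closed[OF \<open>alg P\<close> f args] .
    show "p i (\<phi> (interp T f as)) = p i (interp P f (map \<phi> as))" if "i \<in> I" for i
      using algebra_mapD(2)[OF maps[OF that] f args] algebra_mapD(2)[OF lifts[OF that] f as]
      by (simp add: comp_def)
  qed
  then show ?thesis using \<phi> by (intro algebra_mapI)
qed

lemma one_element_algebra: obtains T x where "alg T" and "U T = {x}"
proof -
  obtain u x where u: "elts u = {x :: 'u}" using pairing[of undefined undefined] by auto
  obtain T where "alg T" "carrier T = u"
    by (rule initial_structure[of "{} :: unit set" undefined u undefined]) (use u in auto)
  with u that show ?thesis by simp
qed

lemma subalgebra:
  assumes "alg X" and "S \<subseteq> U X"
    and closed: "\<And>f xs. f \<in> elts (symbols V) \<Longrightarrow> length xs = arity V f \<Longrightarrow> set xs \<subseteq> S \<Longrightarrow>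
      interp X f xs \<in> S"
  obtains A where "alg A" and "U A = S" and "algebra_map A X (\<lambda>x. x)"
proof -
  obtain u where u: "elts u = S" using separation[OF assms(2)] by blast
  obtain A where "alg A" "carrier A = u" "algebra_map A X (\<lambda>x. x)"
    by (rule initial_structure[of "{()}" "\<lambda>_. X" u "\<lambda>_ x. x"])
      (use u assms(1,2) closed in \<open>auto simp: subset_iff\<close>)
  with u that show ?thesis by simp
qed

lemma algebra_map_corestrict:
  assumes "alg T" and "alg A" and "algebra_map A X (\<lambda>x. x)" and "algebra_map T X \<phi>"
    and "\<And>t. t \<in> U T \<Longrightarrow> \<phi> t \<in> U A"
  shows "algebra_map T A \<phi>"
  by (rule algebra_map_lift[of T A "{()}" "\<lambda>_. X" "\<lambda>_ x. x"]) (use assms in auto)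

lemma fibre_product:
  assumes "alg A" and "alg B" and "alg Q" and f: "algebra_map A Q f" and g: "algebra_map B Q g"
  obtains P p where "alg P"
    and "bij_betw p (U P) {(a, b). a \<in> U A \<and> b \<in> U B \<and> f a = g b}"
    and "algebra_map P A (\<lambda>y. fst (p y))" and "algebra_map P B (\<lambda>y. snd (p y))"
    and "\<And>T \<phi> \<psi>. alg T \<Longrightarrow> algebra_map T A \<phi> \<Longrightarrow> algebra_map T B \<psi> \<Longrightarrow>
      (\<And>t. t \<in> U T \<Longrightarrow> f (\<phi> t) = g (\<psi> t)) \<Longrightarrow>
      algebra_map T P (\<lambda>t. inv_into (U P) p (\<phi> t, \<psi> t))"
proof -
  let ?W = "{(a, b). a \<in> U A \<and> b \<in> U B \<and> f a = g b}"
  have "small elts ?W"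
    by (rule small_subset[of "U A \<times> U B"]) (auto intro: small_Times)
  then obtain u r where r: "bij_betw r ?W (elts u)" unfolding small_def by blast
  define p where "p = inv_into ?W r"
  have p: "bij_betw p (elts u) ?W"
    unfolding p_def using r by (rule bij_betw_inv_into)
  have pW: "fst (p x) \<in> U A" "snd (p x) \<in> U B" "f (fst (p x)) = g (snd (p x))"
    if "x \<in> elts u" for x
    using bspec[OF bij_betwE[OF p] that] by auto
  have p_inj: "x = y"
    if "x \<in> elts u" "y \<in> elts u" "fst (p x) = fst (p y)" "snd (p x) = snd (p y)" for x y
    using p that by (auto simp: bij_betw_def inj_on_def prod_eq_iff)
  define D where "D i = (if i then A else B)" for i
  define pr where "pr i = (if i then (\<lambda>y. fst (p y)) else (\<lambda>y. snd (p y)))" for i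
  have D [simp]: "D True = A" "D False = B" and pr [simp]: "pr True = (\<lambda>y. fst (p y))"
    "pr False = (\<lambda>y. snd (p y))"
    by (simp_all add: D_def pr_def)
  obtain P where P: "alg P" "carrier P = u" "\<And>i. i \<in> UNIV \<Longrightarrow> algebra_map P (D i) (pr i)"
  proof (rule initial_structure[of UNIV D u pr])
    fix h xs assume h: "h \<in> elts (symbols V)" "length xs = arity V h" and xs: "set xs \<subseteq> elts u"
    let ?a = "interp A h (map (\<lambda>y. fst (p y)) xs)" and ?b = "interp B h (map (\<lambda>y. snd (p y)) xs)"
    have args: "map (\<lambda>y. fst (p y)) xs \<in> arguments elts V A h"
      "map (\<lambda>y. snd (p y)) xs \<in> arguments elts V B h"
      using h xs pW by (auto simp: arguments_def subset_iff)
    have "map f (map (\<lambda>y. fst (p y)) xs) = map g (map (\<lambda>y. snd (p y)) xs)"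
      using xs pW by auto
    then have "f ?a = g ?b"
      using algebra_mapD(2)[OF f h(1) args(1)] algebra_mapD(2)[OF g h(1) args(2)]
      by (simp del: map_map map_eq_conv)
    then have "(?a, ?b) \<in> ?W"
      using interp_closed[OF assms(1) h(1) args(1)] interp_closed[OF assms(2) h(1) args(2)] by simp
    then have "(?a, ?b) \<in> p ` elts u"
      using p by (simp add: bij_betw_def)
    then obtain x where "x \<in> elts u" "p x = (?a, ?b)"
      by (elim imageE) (rule that, auto)
    then show "\<exists>x\<in>elts u. \<forall>i\<in>UNIV. pr i x = interp (D i) h (map (pr i) xs)"
      by (intro bexI[of _ x]) (simp_all add: UNIV_bool)
  next
    show "x = y" if "x \<in> elts u" "y \<in> elts u" "\<And>i. i \<in> UNIV \<Longrightarrow> pr i x = pr i y" for x y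
      using p_inj[OF that(1,2)] that(3)[of True] that(3)[of False] by simp
    show "alg (D i)" for i using assms(1,2) by (cases i) simp_all
    show "pr i x \<in> U (D i)" if "x \<in> elts u" for i x using pW[OF that] by (cases i) simp_all
  qed blast
  have maps: "algebra_map P A (\<lambda>y. fst (p y))" "algebra_map P B (\<lambda>y. snd (p y))"
    using P(3)[of True] P(3)[of False] by simp_all
  have lift: "algebra_map T P (\<lambda>t. inv_into (U P) p (\<phi> t, \<psi> t))"
    if T: "alg T" and \<phi>: "algebra_map T A \<phi>" and \<psi>: "algebra_map T B \<psi>"
      and eq: "\<And>t. t \<in> U T \<Longrightarrow> f (\<phi> t) = g (\<psi> t)" for T \<phi> \<psi>
  proof -
    let ?h = "\<lambda>t. inv_into (U P) p (\<phi> t, \<psi> t)"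
    have W: "(\<phi> t, \<psi> t) \<in> p ` U P" if "t \<in> U T" for t
      using p algebra_mapD(1)[OF \<phi> that] algebra_mapD(1)[OF \<psi> that] eq[OF that]
      by (simp add: P(2) bij_betw_def)
    have ph: "p (?h t) = (\<phi> t, \<psi> t)" if "t \<in> U T" for t
      using W[OF that] by (rule f_inv_into_f)
    show ?thesis
    proof (rule algebra_map_lift[of T P UNIV D pr])
      show "algebra_map T (D i) (\<lambda>t. pr i (?h t))" for i
        by (rule algebra_map_cong[OF T, of "if i then \<phi> else \<psi>"]; cases i)
          (simp_all add: \<phi> \<psi> ph)
      show "x = y" if "x \<in> U P" "y \<in> U P" "\<And>i. i \<in> UNIV \<Longrightarrow> pr i x = pr i y" for x y
        using p_inj[OF that(1,2)[unfolded P(2)]] that(3)[of True] that(3)[of False] by simp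
      show "?h t \<in> U P" if "t \<in> U T" for t using W[OF that] by (rule inv_into_into)
    qed (use T P in auto)
  qed
  show ?thesis
  proof (rule that[of P p])
    show "bij_betw p (U P) ?W" using p by (simp add: P(2))
    show "algebra_map T P (\<lambda>t. inv_into (U P) p (\<phi> t, \<psi> t))"
      if "alg T" "algebra_map T A \<phi>" "algebra_map T B \<psi>" "\<And>t. t \<in> U T \<Longrightarrow> f (\<phi> t) = g (\<psi> t)"
      for T \<phi> \<psi>
      using that by (rule lift)
  qed (fact P(1) maps)+
qed

text \<open>
  The image of a value under a map depends only on the images of the generators. This makes the
  image in \<open>Q\<close> of a term the same for all extensions of \<open>Q\<close> by \<open>K\<close>.
\<close>

lemma gen_eval_algebra_map:
  assumes "alg A" and "algebra_map A B \<phi>"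
    and "\<And>g. g \<in> G \<Longrightarrow> v g \<in> U A" and "\<And>g. g \<in> G \<Longrightarrow> \<phi> (v g) = w g"
    and "t \<in> terms (elts (symbols V)) (arity V) G"
  shows "gen_eval A v t \<in> U A \<and> \<phi> (gen_eval A v t) = gen_eval B w t"
  using assms(5)
proof induction
  case (Gen g)
  then show ?case using assms(3,4) by simp
next
  case (Op f ts)
  have args: "map (gen_eval A v) ts \<in> arguments elts V A f"
    using Op by (auto simp: arguments_def)
  moreover have "map \<phi> (map (gen_eval A v) ts) = map (gen_eval B w) ts"
    using Op by simp
  ultimately show ?case
    using Op(1) interp_closed[OF assms(1) Op(1) args] algebra_mapD(2)[OF assms(2) Op(1) args]
    by (simp del: map_map map_eq_conv)
qed

end


section \<open>Zero elements and short exact sequences\<close>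

lemma ex1_unique: "\<exists>!x. P x \<Longrightarrow> P a \<Longrightarrow> P b \<Longrightarrow> a = b"
  by blast

locale pointed_variety = variety_in_universe +
  assumes pointed: "pointed \<V>"
begin

lemma terminal_singleton:
  assumes "terminal \<V> Z"
  obtains z where "U Z = {z}"
proof -
  obtain T x where T: "alg T" "U T = {x}" by (rule one_element_algebra)
  have Z: "alg Z" and unique: "\<And>A. alg A \<Longrightarrow> \<exists>!f. f \<in> hom \<V> A Z"
    using assms by (simp_all add: terminal_def Obj_iff)
  obtain \<phi> where \<phi>: "algebra_map T Z \<phi>"
    using unique[OF T(1)] unfolding hom_iff by blast
  have \<psi>: "algebra_map Z T (\<lambda>_. x)"
  proof (rule algebra_mapI)
    fix f as assume f: "f \<in> elts (symbols V)" and as: "as \<in> arguments elts V Z f"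
    have "map (\<lambda>_. x) as \<in> arguments elts V T f"
      using as T by (auto simp: arguments_def)
    then show "x = interp T f (map (\<lambda>_. x) as)"
      using interp_closed[OF T(1) f] T(2) by (metis singletonD)
  qed (simp add: T)
  have "arr Z Z (\<lambda>_. \<phi> x) = arr Z Z (\<lambda>y. y)"
    using unique[OF Z] arr_in_hom[OF Z Z algebra_map_comp[OF \<psi> \<phi>]]
      arr_in_hom[OF Z Z algebra_map_id] by blast
  then have "\<forall>y\<in>U Z. y = \<phi> x" unfolding arr_eq_iff by metis
  moreover have "\<phi> x \<in> U Z" using algebra_mapD(1)[OF \<phi>] T(2) by simp
  ultimately have "U Z = {\<phi> x}" by blast
  then show ?thesis by (rule that)
qed

lemma zero_algebra:
  obtains Z z where "zero_object \<V> Z" and "alg Z" and "U Z = {z}"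
proof -
  obtain Z where Z: "zero_object \<V> Z" using pointed unfolding pointed_def by blast
  then obtain z where "U Z = {z}" using terminal_singleton unfolding zero_object_def by blast
  moreover have "alg Z" using Z by (simp add: zero_object_def terminal_def Obj_iff)
  ultimately show ?thesis using that Z by blast
qed

definition idempotent :: "'a algebra \<Rightarrow> 'a \<Rightarrow> bool" where
  "idempotent A x \<longleftrightarrow> x \<in> U A \<and>
    (\<forall>f\<in>elts (symbols V). interp A f (replicate (arity V f) x) = x)"

text \<open>
  The point \<open>0\<close> of an algebra is the image of the initial algebra, which has one element. Maps from
  that algebra correspond to one-element subalgebras, so \<open>0\<close> is the only idempotent element.
\<close>

definition zero :: "'a algebra \<Rightarrow> 'a" where
  "zero A = (THE x. idempotent A x)"

lemma const_algebra_map: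
  "idempotent B x \<Longrightarrow> algebra_map A B (\<lambda>_. x)"
  by (rule algebra_mapI) (auto simp: idempotent_def arguments_def map_replicate_const)

lemma idempotent_image:
  assumes "idempotent A x" and "algebra_map A B \<phi>"
  shows "idempotent B (\<phi> x)"
proof -
  have "interp B f (replicate (arity V f) (\<phi> x)) = \<phi> x" if "f \<in> elts (symbols V)" for f
  proof -
    have "replicate (arity V f) x \<in> arguments elts V A f"
      using assms(1) by (auto simp: idempotent_def arguments_def)
    then show ?thesis
      using algebra_mapD(2)[OF assms(2) that, of "replicate (arity V f) x"] assms(1) that
      by (simp add: idempotent_def)
  qed
  then show ?thesis
    using assms algebra_mapD(1)[OF assms(2)] by (simp add: idempotent_def)
qed

lemma ex1_idempotent:
  assumes A: "alg A"
  shows "\<exists>!x. idempotent A x"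
proof -
  obtain Z z where Z: "zero_object \<V> Z" "alg Z" "U Z = {z}" by (rule zero_algebra)
  have unique: "\<exists>!f. f \<in> hom \<V> Z A"
    using Z(1) A by (simp add: zero_object_def initial_def Obj_iff)
  obtain \<phi> where \<phi>: "algebra_map Z A \<phi>"
    using ex1_implies_ex[OF unique] unfolding hom_iff by blast
  have "interp Z f (replicate (arity V f) z) = z" if f: "f \<in> elts (symbols V)" for f
  proof -
    have "replicate (arity V f) z \<in> arguments elts V Z f"
      unfolding arguments_def Z(3) by auto
    then have "interp Z f (replicate (arity V f) z) \<in> U Z"
      by (rule interp_closed[OF Z(2) f])
    then show ?thesis unfolding Z(3) by (rule singletonD)
  qed
  then have "idempotent Z z" unfolding idempotent_def Z(3) by blast
  then have idem: "idempotent A (\<phi> z)" using \<phi> by (rule idempotent_image)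
  have "x = y" if "idempotent A x" "idempotent A y" for x y
  proof -
    have "arr Z A (\<lambda>_. x) = arr Z A (\<lambda>_. y)"
      using that by (intro ex1_unique[OF unique] arr_in_hom[OF Z(2) A] const_algebra_map)
    then show ?thesis using Z(3) by (simp add: arr_eq_iff)
  qed
  from ex1I[of "idempotent A", OF idem this[OF _ idem]] show ?thesis .
qed

lemma idempotent_zero: "alg A \<Longrightarrow> idempotent A (zero A)"
  unfolding zero_def by (rule theI') (rule ex1_idempotent)

lemma zero_closed: "alg A \<Longrightarrow> zero A \<in> U A"
  using idempotent_zero idempotent_def by blast

lemma algebra_map_zero:
  assumes "alg A" and "alg B" and "algebra_map A B \<phi>"
  shows "\<phi> (zero A) = zero B"
  by (rule ex1_unique[OF ex1_idempotent[OF assms(2)]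
        idempotent_image[OF idempotent_zero[OF assms(1)] assms(3)] idempotent_zero[OF assms(2)]])

lemma zero_map: "alg B \<Longrightarrow> algebra_map A B (\<lambda>_. zero B)"
  by (rule const_algebra_map) (rule idempotent_zero)

lemma zero_arrow_iff:
  assumes "alg A" and "alg B" and "algebra_map A B \<phi>"
  shows "zero_arrow \<V> (arr A B \<phi>) \<longleftrightarrow> (\<forall>x\<in>U A. \<phi> x = zero B)"
proof
  assume "zero_arrow \<V> (arr A B \<phi>)"
  then obtain Z g h where Z: "zero_object \<V> Z" and g: "g \<in> hom \<V> A Z" and h: "h \<in> hom \<V> Z B"
    and eq: "arr A B \<phi> = h \<cdot>\<^bsub>\<V>\<^esub> g"
    unfolding zero_arrow_def Dom_Cod_arr by blast
  obtain \<gamma> where \<gamma>: "alg Z" "algebra_map A Z \<gamma>" "g = arr A Z \<gamma>"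
    using g unfolding hom_iff by blast
  obtain \<eta> where \<eta>: "algebra_map Z B \<eta>" "h = arr Z B \<eta>"
    using h unfolding hom_iff by blast
  have "arr A B \<phi> = arr A B (\<lambda>x. \<eta> (\<gamma> x))"
    using eq by (simp only: \<gamma>(3) \<eta>(2) Comp_arr[OF \<gamma>(2)])
  then have \<phi>: "\<phi> x = \<eta> (\<gamma> x)" if "x \<in> U A" for x
    using that by (simp add: arr_eq_iff)
  obtain z where z: "U Z = {z}"
    using Z terminal_singleton unfolding zero_object_def by blast
  then have "zero Z = z" using zero_closed[OF \<gamma>(1)] by simp
  then show "\<forall>x\<in>U A. \<phi> x = zero B"
    using \<phi> algebra_mapD(1)[OF \<gamma>(2)] algebra_map_zero[OF \<gamma>(1) assms(2) \<eta>(1)]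
    unfolding z by simp
next
  assume \<phi>: "\<forall>x\<in>U A. \<phi> x = zero B"
  obtain Z z where Z: "zero_object \<V> Z" "alg Z" "U Z = {z}" by (rule zero_algebra)
  have "arr A B \<phi> = arr Z B (\<lambda>_. zero B) \<cdot>\<^bsub>\<V>\<^esub> arr A Z (\<lambda>_. zero Z)"
    using \<phi> by (simp add: Comp_arr[OF zero_map[OF Z(2)]] arr_eq_iff)
  moreover have "arr A Z (\<lambda>_. zero Z) \<in> hom \<V> A Z" "arr Z B (\<lambda>_. zero B) \<in> hom \<V> Z B"
    using assms Z by (simp_all add: arr_in_hom zero_map)
  ultimately show "zero_arrow \<V> (arr A B \<phi>)"
    unfolding zero_arrow_def Dom_Cod_arr using Z(1) arr_in_Arr[OF assms]
    by (intro conjI exI[of _ Z] bexI)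
qed

definition exact_sequence ::
  "'a algebra \<Rightarrow> 'a algebra \<Rightarrow> 'a algebra \<Rightarrow> ('a \<Rightarrow> 'a) \<Rightarrow> ('a \<Rightarrow> 'a) \<Rightarrow> bool" where
  "exact_sequence K X Q \<kappa> \<pi> \<longleftrightarrow> alg K \<and> alg X \<and> alg Q \<and> algebra_map K X \<kappa> \<and> algebra_map X Q \<pi> \<and>
    inj_on \<kappa> (U K) \<and> \<kappa> ` U K = {x \<in> U X. \<pi> x = zero Q} \<and> \<pi> ` U X = U Q"

lemma interp_zeros:
  assumes "alg Q" and "f \<in> elts (symbols V)" and "length xs = arity V f"
    and "\<And>x. x \<in> set xs \<Longrightarrow> x = zero Q"
  shows "interp Q f xs = zero Q"
proof -
  have "xs = replicate (arity V f) (zero Q)"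
    using assms(3,4) by (intro replicate_eqI)
  then show ?thesis using idempotent_zero[OF assms(1)] assms(2) by (simp add: idempotent_def)
qed

text \<open>
  A kernel is compared with the subalgebra of elements sent to \<open>0\<close>, and a cokernel with the
  subalgebra of its values. Factoring the inclusion of the former through the kernel, or the
  corestriction to the latter through the cokernel, gives the elementwise description.
\<close>

lemma short_exact_sequence_elements:
  assumes "(k, q) \<in> short_exact_sequences \<V> K Q"
  obtains X \<kappa> \<pi> where "k = arr K X \<kappa>" and "q = arr X Q \<pi>" and "exact_sequence K X Q \<kappa> \<pi>"
proof -
  have dom: "Dom \<V> k = K" and cod: "Cod \<V> q = Q" and ker: "kernel \<V> q k" and coker: "cokernel \<V> k q"
    using assms by (simp_all add: short_exact_sequences_def)
  have "q \<in> Arr \<V>" "k \<in> Arr \<V>" and mid: "Cod \<V> k = Dom \<V> q"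
    using ker by (simp_all add: kernel_def)
  obtain X \<pi> where q: "q = arr X Q \<pi>" and "alg X" "alg Q" and \<pi>: "algebra_map X Q \<pi>"
    using \<open>q \<in> Arr \<V>\<close> cod unfolding Arr_iff by auto
  obtain \<kappa> where k: "k = arr K X \<kappa>" and "alg K" and \<kappa>: "algebra_map K X \<kappa>"
    using \<open>k \<in> Arr \<V>\<close> dom mid unfolding Arr_iff q by auto
  note algs = \<open>alg K\<close> \<open>alg X\<close> \<open>alg Q\<close>
  have qk: "q \<cdot>\<^bsub>\<V>\<^esub> k = arr K Q (\<lambda>x. \<pi> (\<kappa> x))"
    unfolding k q using \<kappa> by (rule Comp_arr)
  have "zero_arrow \<V> (q \<cdot>\<^bsub>\<V>\<^esub> k)" using ker by (simp add: kernel_def)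
  then have zero: "\<pi> (\<kappa> x) = zero Q" if "x \<in> U K" for x
    unfolding qk zero_arrow_iff[OF algs(1,3) algebra_map_comp[OF \<kappa> \<pi>]] using that by blast
  have kernel_factor: "\<exists>!h. h \<in> hom \<V> (Dom \<V> t) (Dom \<V> k) \<and> k \<cdot>\<^bsub>\<V>\<^esub> h = t"
    if "t \<in> Arr \<V>" "Cod \<V> t = Dom \<V> q" "zero_arrow \<V> (q \<cdot>\<^bsub>\<V>\<^esub> t)" for t
    using ker that unfolding kernel_def by simp
  have cokernel_factor: "\<exists>!h. h \<in> hom \<V> (Cod \<V> q) (Cod \<V> t) \<and> h \<cdot>\<^bsub>\<V>\<^esub> q = t"
    if "t \<in> Arr \<V>" "Dom \<V> t = Cod \<V> k" "zero_arrow \<V> (t \<cdot>\<^bsub>\<V>\<^esub> k)" for t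
    using coker that unfolding cokernel_def by simp
  have factor_k: "\<exists>!h. h \<in> hom \<V> T K \<and> k \<cdot>\<^bsub>\<V>\<^esub> h = arr T X \<tau>"
    if T: "alg T" and \<tau>: "algebra_map T X \<tau>" and "\<And>t. t \<in> U T \<Longrightarrow> \<pi> (\<tau> t) = zero Q" for T \<tau>
  proof -
    have "zero_arrow \<V> (q \<cdot>\<^bsub>\<V>\<^esub> arr T X \<tau>)"
      unfolding q Comp_arr[OF \<tau>] zero_arrow_iff[OF T algs(3) algebra_map_comp[OF \<tau> \<pi>]]
      using that(3) by blast
    with kernel_factor[OF arr_in_Arr[OF T algs(2) \<tau>]] show ?thesis by (simp add: k q)
  qed
  have factor_q: "\<exists>!h. h \<in> hom \<V> Q T \<and> h \<cdot>\<^bsub>\<V>\<^esub> q = arr X T \<tau>"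
    if T: "alg T" and \<tau>: "algebra_map X T \<tau>" and "\<And>x. x \<in> U K \<Longrightarrow> \<tau> (\<kappa> x) = zero T" for T \<tau>
  proof -
    have "zero_arrow \<V> (arr X T \<tau> \<cdot>\<^bsub>\<V>\<^esub> k)"
      unfolding k Comp_arr[OF \<kappa>] zero_arrow_iff[OF algs(1) T algebra_map_comp[OF \<kappa> \<tau>]]
      using that(3) by blast
    with cokernel_factor[OF arr_in_Arr[OF algs(2) T \<tau>]] show ?thesis by (simp add: k q)
  qed

  let ?N = "{x \<in> U X. \<pi> x = zero Q}"
  obtain N where N: "alg N" "U N = ?N" and inclN: "algebra_map N X (\<lambda>x. x)"
  proof (rule subalgebra[OF algs(2), of ?N])
    fix f xs assume f: "f \<in> elts (symbols V)" "length xs = arity V f" and xs: "set xs \<subseteq> ?N"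
    have args: "xs \<in> arguments elts V X f" using f xs by (auto simp: arguments_def)
    have "interp Q f (map \<pi> xs) = zero Q"
      by (rule interp_zeros[OF algs(3) f(1)]) (use f xs in auto)
    then show "interp X f xs \<in> ?N"
      using interp_closed[OF algs(2) f(1) args] algebra_mapD(2)[OF \<pi> f(1) args] by simp
  next
    show "?N \<subseteq> U X" by blast
  qed (rule that)
  have "\<pi> x = zero Q" if "x \<in> U N" for x using that N(2) by simp
  then obtain h where "h \<in> hom \<V> N K" "k \<cdot>\<^bsub>\<V>\<^esub> h = arr N X (\<lambda>x. x)"
    using ex1_implies_ex[OF factor_k[OF N(1) inclN]] by blast
  then obtain \<eta> where \<eta>: "algebra_map N K \<eta>" "k \<cdot>\<^bsub>\<V>\<^esub> arr N K \<eta> = arr N X (\<lambda>x. x)"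
    unfolding hom_iff by blast
  then have \<kappa>\<eta>: "\<kappa> (\<eta> x) = x" if "x \<in> ?N" for x
    using that N(2) unfolding k Comp_arr[OF \<eta>(1)] arr_eq_iff by blast
  have \<kappa>N: "\<kappa> x \<in> ?N" if "x \<in> U K" for x
    using zero[OF that] algebra_mapD(1)[OF \<kappa> that] by simp
  have image_\<kappa>: "\<kappa> ` U K = ?N"
  proof
    show "?N \<subseteq> \<kappa> ` U K"
    proof
      fix x assume x: "x \<in> ?N"
      then have "\<eta> x \<in> U K" using algebra_mapD(1)[OF \<eta>(1), of x] N(2) by simp
      then show "x \<in> \<kappa> ` U K" using imageI[of "\<eta> x" "U K" \<kappa>] by (simp only: \<kappa>\<eta>[OF x])
    qed
  qed (use \<kappa>N in blast)
  \<comment> \<open>\<open>\<kappa>\<close> factors through itself by the identity and by \<open>\<eta> \<circ> \<kappa>\<close>; these agree, so \<open>\<kappa>\<close> is injective.\<close>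
  have \<kappa>N_map: "algebra_map K N \<kappa>"
    by (rule algebra_map_corestrict[OF algs(1) N(1) inclN \<kappa>]) (use \<kappa>N N(2) in blast)
  have \<eta>\<kappa>_map: "algebra_map K K (\<lambda>x. \<eta> (\<kappa> x))"
    using \<kappa>N_map \<eta>(1) by (rule algebra_map_comp)
  have "arr K K (\<lambda>x. \<eta> (\<kappa> x)) = arr K K (\<lambda>x. x)"
  proof -
    have "k \<cdot>\<^bsub>\<V>\<^esub> arr K K (\<lambda>x. \<eta> (\<kappa> x)) = arr K X \<kappa>" "k \<cdot>\<^bsub>\<V>\<^esub> arr K K (\<lambda>x. x) = arr K X \<kappa>"
      unfolding k Comp_arr[OF \<eta>\<kappa>_map] Comp_arr[OF algebra_map_id] arr_eq_iff
      using \<kappa>\<eta>[OF \<kappa>N] by simp_all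
    moreover have "arr K K (\<lambda>x. \<eta> (\<kappa> x)) \<in> hom \<V> K K" "arr K K (\<lambda>x. x) \<in> hom \<V> K K"
      by (rule arr_in_hom[OF algs(1) algs(1)], rule \<eta>\<kappa>_map algebra_map_id)+
    ultimately show ?thesis
      by (intro ex1_unique[OF factor_k[OF algs(1) \<kappa> zero]]) simp_all
  qed
  then have inj_\<kappa>: "inj_on \<kappa> (U K)"
    by (intro inj_on_inverseI[of _ \<eta>]) (simp add: arr_eq_iff)

  let ?M = "\<pi> ` U X"
  have M_sub: "?M \<subseteq> U Q" using algebra_mapD(1)[OF \<pi>] by blast
  obtain M where M: "alg M" "U M = ?M" and inclM: "algebra_map M Q (\<lambda>x. x)"
  proof (rule subalgebra[OF algs(3) M_sub])
    fix f ys assume f: "f \<in> elts (symbols V)" "length ys = arity V f" and ys: "set ys \<subseteq> ?M"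
    let ?xs = "map (inv_into (U X) \<pi>) ys"
    have args: "?xs \<in> arguments elts V X f"
      using f ys by (auto simp: arguments_def intro: inv_into_into)
    have "map \<pi> ?xs = ys"
      using ys by (auto simp: f_inv_into_f intro!: map_idI)
    then have "interp Q f ys = \<pi> (interp X f ?xs)"
      using algebra_mapD(2)[OF \<pi> f(1) args] by (simp del: map_map)
    then show "interp Q f ys \<in> ?M"
      using interp_closed[OF algs(2) f(1) args] by blast
  qed (rule that)
  have \<pi>M: "algebra_map X M \<pi>"
    by (rule algebra_map_corestrict[OF algs(2) M(1) inclM \<pi>]) (use M(2) in blast)
  have "zero M = zero Q"
    using algebra_map_zero[OF M(1) algs(3) inclM] .
  then have "\<pi> (\<kappa> x) = zero M" if "x \<in> U K" for x using zero[OF that] by simp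
  then obtain h where "h \<in> hom \<V> Q M" "h \<cdot>\<^bsub>\<V>\<^esub> q = arr X M \<pi>"
    using ex1_implies_ex[OF factor_q[OF M(1) \<pi>M]] by blast
  then obtain \<theta> where \<theta>: "algebra_map Q M \<theta>" "arr Q M \<theta> \<cdot>\<^bsub>\<V>\<^esub> q = arr X M \<pi>"
    unfolding hom_iff by blast
  then have \<theta>\<pi>: "\<theta> (\<pi> x) = \<pi> x" if "x \<in> U X" for x
    using that unfolding q Comp_arr[OF \<pi>] arr_eq_iff by blast
  have \<theta>_map: "algebra_map Q Q \<theta>"
    using algebra_map_comp[OF \<theta>(1) inclM] .
  have "arr Q Q \<theta> = arr Q Q (\<lambda>y. y)"
  proof -
    have "arr Q Q \<theta> \<cdot>\<^bsub>\<V>\<^esub> q = arr X Q \<pi>" "arr Q Q (\<lambda>y. y) \<cdot>\<^bsub>\<V>\<^esub> q = arr X Q \<pi>"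
      unfolding q Comp_arr[OF \<pi>] arr_eq_iff using \<theta>\<pi> by simp_all
    moreover have "arr Q Q \<theta> \<in> hom \<V> Q Q" "arr Q Q (\<lambda>y. y) \<in> hom \<V> Q Q"
      by (rule arr_in_hom[OF algs(3) algs(3)], rule \<theta>_map algebra_map_id)+
    ultimately show ?thesis
      by (intro ex1_unique[OF factor_q[OF algs(3) \<pi> zero]]) simp_all
  qed
  then have "\<forall>y\<in>U Q. \<theta> y = y" unfolding arr_eq_iff by blast
  then have "y \<in> ?M" if "y \<in> U Q" for y
    using algebra_mapD(1)[OF \<theta>(1) that] that M(2) by simp
  then have "\<pi> ` U X = U Q" using M_sub by blast
  with image_\<kappa> inj_\<kappa> algs \<kappa> \<pi> have "exact_sequence K X Q \<kappa> \<pi>"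
    by (simp add: exact_sequence_def)
  with k q show ?thesis by (rule that)
qed

end


section \<open>Extensions are generated by the kernel and a section\<close>

locale pointed_protomodular_variety = pointed_variety +
  assumes protomodular: "protomodular \<V>"
begin

text \<open>
  The base change of a point along \<open>0\<close> is the kernel. Stated for a monomorphism \<open>\<iota>\<close> whose image is
  the kernel of \<open>f\<close>, so that points with the same kernel get literally the same base change.
\<close>

lemma pullback_along_zero:
  assumes Z: "alg Z" "U Z = {z}" and algs: "alg K" "alg P" "alg S"
    and f: "algebra_map P S f" and \<iota>: "algebra_map K P \<iota>" "inj_on \<iota> (U K)"
    and image: "\<iota> ` U K = {y \<in> U P. f y = zero S}"
  shows "pullback \<V> (arr Z S (\<lambda>_. zero S)) (arr P S f) (arr K Z (\<lambda>_. zero Z)) (arr K P \<iota>)"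
proof -
  have maps: "algebra_map Z S (\<lambda>_. zero S)" "algebra_map K Z (\<lambda>_. zero Z)"
    using Z(1) algs by (simp_all add: zero_map)
  have zZ: "zero Z = z" using zero_closed[OF Z(1)] Z(2) by simp
  have f\<iota>: "f (\<iota> x) = zero S" if "x \<in> U K" for x
    using image imageI[OF that, of \<iota>] by simp
  have lift: "\<exists>!h. h \<in> hom \<V> T K \<and> arr K Z (\<lambda>_. zero Z) \<cdot>\<^bsub>\<V>\<^esub> h = u \<and> arr K P \<iota> \<cdot>\<^bsub>\<V>\<^esub> h = v"
    if u: "u \<in> hom \<V> T Z" and v: "v \<in> hom \<V> T P"
      and eq: "arr Z S (\<lambda>_. zero S) \<cdot>\<^bsub>\<V>\<^esub> u = arr P S f \<cdot>\<^bsub>\<V>\<^esub> v" for T u v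
  proof -
    obtain \<mu> where T: "alg T" and \<mu>: "algebra_map T Z \<mu>" "u = arr T Z \<mu>"
      using u unfolding hom_iff by blast
    obtain \<nu> where \<nu>: "algebra_map T P \<nu>" "v = arr T P \<nu>"
      using v unfolding hom_iff by blast
    have "arr T S (\<lambda>_. zero S) = arr T S (\<lambda>x. f (\<nu> x))"
      using eq by (simp only: \<mu>(2) \<nu>(2) Comp_arr[OF \<mu>(1)] Comp_arr[OF \<nu>(1)])
    then have f\<nu>: "f (\<nu> t) = zero S" if "t \<in> U T" for t
      using that by (simp add: arr_eq_iff)
    have \<nu>_image: "\<nu> t \<in> \<iota> ` U K" if "t \<in> U T" for t
      unfolding image using f\<nu>[OF that] algebra_mapD(1)[OF \<nu>(1) that] by simp
    define \<eta> where "\<eta> t = inv_into (U K) \<iota> (\<nu> t)" for t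
    have \<eta>_closed: "\<eta> t \<in> U K" if "t \<in> U T" for t
      unfolding \<eta>_def using \<nu>_image[OF that] by (rule inv_into_into)
    have \<iota>\<eta>: "\<iota> (\<eta> t) = \<nu> t" if "t \<in> U T" for t
      unfolding \<eta>_def using \<nu>_image[OF that] by (rule f_inv_into_f)
    have \<eta>: "algebra_map T K \<eta>"
    proof (rule algebra_map_lift[OF T algs(1), of "{()}" "\<lambda>_. P" "\<lambda>_. \<iota>"])
      show "x = y" if "x \<in> U K" "y \<in> U K" "\<And>i. i \<in> {()} \<Longrightarrow> \<iota> x = \<iota> y" for x y
        using inj_onD[OF \<iota>(2) _ that(1,2)] that(3) by simp
      show "algebra_map T P (\<lambda>t. \<iota> (\<eta> t))"
        by (rule algebra_map_cong[OF T _ \<nu>(1)]) (simp add: \<iota>\<eta>)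
    qed (use \<iota>(1) \<eta>_closed in simp_all)
    have \<mu>z: "\<mu> t = z" if "t \<in> U T" for t
      using algebra_mapD(1)[OF \<mu>(1) that] unfolding Z(2) by (rule singletonD)
    have "arr K Z (\<lambda>_. zero Z) \<cdot>\<^bsub>\<V>\<^esub> arr T K \<eta> = u"
      unfolding \<mu>(2) Comp_arr[OF \<eta>] arr_eq_iff zZ by (simp add: \<mu>z)
    moreover have "arr K P \<iota> \<cdot>\<^bsub>\<V>\<^esub> arr T K \<eta> = v"
      unfolding \<nu>(2) Comp_arr[OF \<eta>] arr_eq_iff by (simp add: \<iota>\<eta>)
    ultimately have factor: "arr T K \<eta> \<in> hom \<V> T K \<and>
        arr K Z (\<lambda>_. zero Z) \<cdot>\<^bsub>\<V>\<^esub> arr T K \<eta> = u \<and> arr K P \<iota> \<cdot>\<^bsub>\<V>\<^esub> arr T K \<eta> = v"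
      using arr_in_hom[OF T algs(1) \<eta>] by (intro conjI)
    have unique: "h = arr T K \<eta>" if h: "h \<in> hom \<V> T K" and hv: "arr K P \<iota> \<cdot>\<^bsub>\<V>\<^esub> h = v" for h
    proof -
      obtain \<eta>' where \<eta>': "algebra_map T K \<eta>'" "h = arr T K \<eta>'"
        using h unfolding hom_iff by blast
      have \<iota>\<eta>': "\<iota> (\<eta>' t) = \<nu> t" if "t \<in> U T" for t
        using hv that unfolding \<eta>'(2) \<nu>(2) Comp_arr[OF \<eta>'(1)] arr_eq_iff by simp
      have "\<eta>' t = \<eta> t" if t: "t \<in> U T" for t
        by (rule inj_onD[OF \<iota>(2) _ algebra_mapD(1)[OF \<eta>'(1) t] \<eta>_closed[OF t]])
          (simp only: \<iota>\<eta>[OF t] \<iota>\<eta>'[OF t])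
      then show ?thesis by (simp add: \<eta>'(2) arr_eq_iff)
    qed
    show ?thesis
      by (rule ex1I[of _ "arr T K \<eta>"], rule factor, rule unique) simp_all
  qed
  have "arr Z S (\<lambda>_. zero S) \<cdot>\<^bsub>\<V>\<^esub> arr K Z (\<lambda>_. zero Z) = arr P S f \<cdot>\<^bsub>\<V>\<^esub> arr K P \<iota>"
    unfolding Comp_arr[OF maps(2)] Comp_arr[OF \<iota>(1)] arr_eq_iff by (simp add: f\<iota>)
  then show ?thesis
    unfolding pullback_def Dom_Cod_arr
    using arr_in_Arr[OF Z(1) algs(3) maps(1)] arr_in_Arr[OF algs(2,3) f]
      arr_in_Arr[OF algs(1) Z(1) maps(2)] arr_in_Arr[OF algs(1,2) \<iota>(1)]
    by (intro conjI allI ballI impI refl lift)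
qed

lemma point_arr:
  assumes "alg P" "alg S" "algebra_map P S f" "algebra_map S P s" "\<And>x. x \<in> U S \<Longrightarrow> f (s x) = x"
  shows "point \<V> S (arr P S f) (arr S P s)"
  unfolding point_def Dom_Cod_arr Comp_arr[OF assms(4)] Id_arr arr_eq_iff
  using assms arr_in_Arr arr_in_hom by simp

lemma iso_arr_surj:
  assumes "iso \<V> (arr P P' h)" and "y \<in> U P'"
  shows "\<exists>x\<in>U P. h x = y"
proof -
  obtain g where g: "g \<in> hom \<V> P' P" "arr P P' h \<cdot>\<^bsub>\<V>\<^esub> g = Id \<V> P'"
    using assms(1) unfolding iso_def Dom_Cod_arr by blast
  obtain \<gamma> where \<gamma>: "algebra_map P' P \<gamma>" "g = arr P' P \<gamma>"
    using g(1) unfolding hom_iff by blast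
  have "h (\<gamma> y) = y"
    using g(2) assms(2) by (simp add: \<gamma>(2) Comp_arr[OF \<gamma>(1)] Id_arr arr_eq_iff)
  then show ?thesis using algebra_mapD(1)[OF \<gamma>(1) assms(2)] by blast
qed

lemma iso_Id:
  assumes "alg A"
  shows "iso \<V> (arr A A (\<lambda>x. x))"
  unfolding iso_def Dom_Cod_arr
  using arr_in_Arr[OF assms assms algebra_map_id] arr_in_hom[OF assms assms algebra_map_id]
  by (auto intro!: bexI[of _ "arr A A (\<lambda>x. x)"] simp: Comp_arr[OF algebra_map_id] Id_arr)

lemma base_change_reflects_iso:
  assumes "b \<in> Arr \<V>" and "point \<V> (Cod \<V> b) f s" and "point \<V> (Cod \<V> b) f' s'"
    and "point_morphism \<V> f s f' s' h" and "pullback \<V> b f e x" and "pullback \<V> b f' e' x'"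
    and "h' \<in> hom \<V> (Dom \<V> e) (Dom \<V> e')" and "e' \<cdot>\<^bsub>\<V>\<^esub> h' = e"
    and "x' \<cdot>\<^bsub>\<V>\<^esub> h' = h \<cdot>\<^bsub>\<V>\<^esub> x" and "iso \<V> h'"
  shows "iso \<V> h"
  using protomodular[unfolded protomodular_def, THEN conjunct2, THEN bspec, OF assms(1)] assms(2-)
  by blast

text \<open>
  A form of the short five lemma. Protomodularity speaks about split epimorphisms only, so \<open>\<pi>\<close> is
  pulled back along its restriction to \<open>A\<close>, where it is split by the diagonal. The inclusion of
  \<open>A \<times>\<^sub>Q A\<close> in \<open>A \<times>\<^sub>Q X\<close> is a morphism of points over \<open>A\<close> that induces the identity of \<open>K\<close> between
  the kernels, hence it is invertible. An element \<open>x\<close> of \<open>X\<close> has the same image in \<open>Q\<close> as some \<open>a\<close> in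
  \<open>A\<close>, and then \<open>(a, x)\<close> belongs to \<open>A \<times>\<^sub>Q X = A \<times>\<^sub>Q A\<close>.
\<close>

lemma subalgebra_over_exact_sequence:
  assumes E: "exact_sequence K X Q \<kappa> \<pi>" and A: "alg A" and incl: "algebra_map A X (\<lambda>x. x)"
    and kernel: "\<kappa> ` U K \<subseteq> U A" and onto: "\<pi> ` U A = U Q"
  shows "U A = U X"
proof -
  have algs: "alg K" "alg X" "alg Q" and \<kappa>: "algebra_map K X \<kappa>" and \<pi>: "algebra_map X Q \<pi>"
    and inj: "inj_on \<kappa> (U K)" and image: "\<kappa> ` U K = {x \<in> U X. \<pi> x = zero Q}"
    using E unfolding exact_sequence_def by simp_all
  obtain Z z where Z: "alg Z" "U Z = {z}" by (rule zero_algebra)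
  have \<pi>A: "algebra_map A Q \<pi>" using algebra_map_comp[OF incl \<pi>] .
  have zero_A: "\<pi> (zero A) = zero Q" using algebra_map_zero[OF A algs(3) \<pi>A] .
  have \<pi>\<kappa>: "\<pi> (\<kappa> x) = zero Q" if "x \<in> U K" for x
    using image imageI[OF that, of \<kappa>] by simp
  have sub: "U A \<subseteq> U X" using algebra_mapD(1)[OF incl] by blast

  \<comment> \<open>The point \<open>A \<times>\<^sub>Q B \<rightarrow> A\<close> with the diagonal as section; used for \<open>B = A\<close> and for \<open>B = X\<close>.\<close>
  define W where "W B = {(a, b). a \<in> U A \<and> b \<in> U B \<and> \<pi> a = \<pi> b}" for B :: "'a algebra"
  have point_over: "\<exists>P p. alg P \<and> bij_betw p (U P) (W B) \<and>
      algebra_map P A (\<lambda>y. fst (p y)) \<and> algebra_map P B (\<lambda>y. snd (p y)) \<and>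
      algebra_map A P (\<lambda>a. inv_into (U P) p (a, a)) \<and>
      algebra_map K P (\<lambda>x. inv_into (U P) p (zero A, \<kappa> x)) \<and>
      (\<forall>T \<phi> \<psi>. alg T \<longrightarrow> algebra_map T A \<phi> \<longrightarrow> algebra_map T B \<psi> \<longrightarrow>
        (\<forall>t\<in>U T. \<pi> (\<phi> t) = \<pi> (\<psi> t)) \<longrightarrow> algebra_map T P (\<lambda>t. inv_into (U P) p (\<phi> t, \<psi> t)))"
    if B: "alg B" "algebra_map B X (\<lambda>x. x)" "algebra_map A B (\<lambda>x. x)" for B
  proof -
    have \<pi>B: "algebra_map B Q \<pi>" using algebra_map_comp[OF B(2) \<pi>] .
    have \<kappa>B: "algebra_map K B \<kappa>"
    proof (rule algebra_map_corestrict[OF algs(1) B(1,2) \<kappa>])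
      fix x assume "x \<in> U K"
      then have "\<kappa> x \<in> U A" using kernel by blast
      then show "\<kappa> x \<in> U B" by (rule algebra_mapD(1)[OF B(3)])
    qed
    show ?thesis
    proof (rule fibre_product[OF A B(1) algs(3) \<pi>A \<pi>B])
      fix P p
      assume P: "alg P" "bij_betw p (U P) {(a, b). a \<in> U A \<and> b \<in> U B \<and> \<pi> a = \<pi> b}"
          "algebra_map P A (\<lambda>y. fst (p y))" "algebra_map P B (\<lambda>y. snd (p y))"
        and lift: "\<And>T \<phi> \<psi>. alg T \<Longrightarrow> algebra_map T A \<phi> \<Longrightarrow> algebra_map T B \<psi> \<Longrightarrow>
          (\<And>t. t \<in> U T \<Longrightarrow> \<pi> (\<phi> t) = \<pi> (\<psi> t)) \<Longrightarrow>
          algebra_map T P (\<lambda>t. inv_into (U P) p (\<phi> t, \<psi> t))"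
      have "algebra_map A P (\<lambda>a. inv_into (U P) p (a, a))"
        by (rule lift[OF A algebra_map_id B(3) refl])
      moreover have "algebra_map K P (\<lambda>x. inv_into (U P) p (zero A, \<kappa> x))"
        by (rule lift[OF algs(1) zero_map[OF A] \<kappa>B]) (simp add: zero_A \<pi>\<kappa>)
      ultimately show ?thesis
        using P lift unfolding W_def by (intro exI[of _ P] exI[of _ p]) simp
    qed
  qed
  obtain P p where P: "alg P" and p: "bij_betw p (U P) (W A)"
    and p1: "algebra_map P A (\<lambda>y. fst (p y))" and p2: "algebra_map P A (\<lambda>y. snd (p y))"
    and d: "algebra_map A P (\<lambda>a. inv_into (U P) p (a, a))"
    and \<iota>: "algebra_map K P (\<lambda>x. inv_into (U P) p (zero A, \<kappa> x))"
    using point_over[OF A incl algebra_map_id] by blast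
  obtain P' p' where P': "alg P'" and p': "bij_betw p' (U P') (W X)"
    and p1': "algebra_map P' A (\<lambda>y. fst (p' y))"
    and d': "algebra_map A P' (\<lambda>a. inv_into (U P') p' (a, a))"
    and \<iota>': "algebra_map K P' (\<lambda>x. inv_into (U P') p' (zero A, \<kappa> x))"
    and lift': "\<And>T \<phi> \<psi>. alg T \<Longrightarrow> algebra_map T A \<phi> \<Longrightarrow> algebra_map T X \<psi> \<Longrightarrow>
        \<forall>t\<in>U T. \<pi> (\<phi> t) = \<pi> (\<psi> t) \<Longrightarrow> algebra_map T P' (\<lambda>t. inv_into (U P') p' (\<phi> t, \<psi> t))"
    using point_over[OF algs(2) algebra_map_id incl] by blast

  have inv: "inv_into (U R) r (a, b) \<in> U R" "r (inv_into (U R) r (a, b)) = (a, b)"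
    if "bij_betw r (U R) (W B)" and "(a, b) \<in> W B" for r a b and R B :: "'a algebra"
  proof -
    have "(a, b) \<in> r ` U R" using that by (simp add: bij_betw_def)
    then show "inv_into (U R) r (a, b) \<in> U R" "r (inv_into (U R) r (a, b)) = (a, b)"
      by (rule inv_into_into, intro f_inv_into_f)
  qed
  have inv_left: "inv_into (U R) r (r y) = y" if "bij_betw r (U R) (W B)" and "y \<in> U R" for r y and R B :: "'a algebra"
    using that by (simp add: bij_betw_def)
  have diag: "(a, a) \<in> W A" "(a, a) \<in> W X" if "a \<in> U A" for a
    using that sub by (auto simp: W_def)
  have ker: "(zero A, \<kappa> x) \<in> W A" "(zero A, \<kappa> x) \<in> W X" if "x \<in> U K" for x
    using that kernel sub zero_closed[OF A] by (auto simp: W_def zero_A \<pi>\<kappa>)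

  \<comment> \<open>The elements \<open>(0, \<kappa> x)\<close> form the kernel of the first projection.\<close>
  have kernel_of_point:
    "inj_on (\<lambda>x. inv_into (U R) r (zero A, \<kappa> x)) (U K)"
    "(\<lambda>x. inv_into (U R) r (zero A, \<kappa> x)) ` U K = {y \<in> U R. fst (r y) = zero A}"
    if r: "bij_betw r (U R) (W B)" and B: "U B \<subseteq> U X"
      and K: "\<And>x. x \<in> U K \<Longrightarrow> (zero A, \<kappa> x) \<in> W B" for r and R B :: "'a algebra"
  proof -
    show "inj_on (\<lambda>x. inv_into (U R) r (zero A, \<kappa> x)) (U K)"
    proof (rule inj_onI)
      fix x y assume x: "x \<in> U K" and y: "y \<in> U K"
        and eq: "inv_into (U R) r (zero A, \<kappa> x) = inv_into (U R) r (zero A, \<kappa> y)"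
      have "(zero A, \<kappa> x) = (zero A, \<kappa> y)"
        using arg_cong[OF eq, of r] by (simp add: inv(2)[OF r K[OF x]] inv(2)[OF r K[OF y]])
      then show "x = y" using inj_onD[OF inj _ x y] by simp
    qed
    show "(\<lambda>x. inv_into (U R) r (zero A, \<kappa> x)) ` U K = {y \<in> U R. fst (r y) = zero A}"
    proof (intro equalityI subsetI)
      fix y assume "y \<in> (\<lambda>x. inv_into (U R) r (zero A, \<kappa> x)) ` U K"
      then obtain x where x: "x \<in> U K" "y = inv_into (U R) r (zero A, \<kappa> x)" by blast
      then show "y \<in> {y \<in> U R. fst (r y) = zero A}"
        using inv[OF r K[OF x(1)]] by simp
    next
      fix y assume y: "y \<in> {y \<in> U R. fst (r y) = zero A}"
      then have "r y \<in> W B" using r bij_betwE by blast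
      then have "snd (r y) \<in> {x \<in> U X. \<pi> x = zero Q}"
        using y B zero_A by (auto simp: W_def)
      then obtain x where x: "x \<in> U K" "snd (r y) = \<kappa> x" unfolding image [symmetric] by blast
      then have "r y = (zero A, \<kappa> x)" using y by (simp add: prod_eq_iff)
      then have "y = inv_into (U R) r (zero A, \<kappa> x)"
        using inv_left[OF r, of y] y by simp
      then show "y \<in> (\<lambda>x. inv_into (U R) r (zero A, \<kappa> x)) ` U K" using x(1) by blast
    qed
  qed

  let ?h = "\<lambda>y. inv_into (U P') p' (fst (p y), snd (p y))"
  have pW: "(fst (p y), snd (p y)) \<in> W A" "(fst (p y), snd (p y)) \<in> W X" if "y \<in> U P" for y
  proof -
    show "(fst (p y), snd (p y)) \<in> W A" using bspec[OF bij_betwE[OF p] that] by simp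
    then show "(fst (p y), snd (p y)) \<in> W X" using sub by (auto simp: W_def)
  qed
  have h: "algebra_map P P' ?h"
  proof (rule lift'[OF P p1])
    show "algebra_map P X (\<lambda>y. snd (p y))" using algebra_map_comp[OF p2 incl] .
    show "\<forall>y\<in>U P. \<pi> (fst (p y)) = \<pi> (snd (p y))"
    proof
      fix y assume "y \<in> U P"
      from pW(1)[OF this] show "\<pi> (fst (p y)) = \<pi> (snd (p y))" unfolding W_def by blast
    qed
  qed
  have p'h: "p' (?h y) = p y" if "y \<in> U P" for y
    using inv(2)[OF p' pW(2)[OF that]] by simp

  let ?b = "arr Z A (\<lambda>_. zero A)" and ?e = "arr K Z (\<lambda>_. zero Z)"
  let ?f = "arr P A (\<lambda>y. fst (p y))" and ?f' = "arr P' A (\<lambda>y. fst (p' y))"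
  let ?s = "arr A P (\<lambda>a. inv_into (U P) p (a, a))"
  let ?s' = "arr A P' (\<lambda>a. inv_into (U P') p' (a, a))"
  let ?x = "arr K P (\<lambda>x. inv_into (U P) p (zero A, \<kappa> x))"
  let ?x' = "arr K P' (\<lambda>x. inv_into (U P') p' (zero A, \<kappa> x))"
  have pt: "point \<V> (Cod \<V> ?b) ?f ?s"
    unfolding Dom_Cod_arr by (rule point_arr[OF P A p1 d]) (simp add: inv(2)[OF p diag(1)])
  have pt': "point \<V> (Cod \<V> ?b) ?f' ?s'"
    unfolding Dom_Cod_arr by (rule point_arr[OF P' A p1' d']) (simp add: inv(2)[OF p' diag(2)])
  have pb: "pullback \<V> ?b ?f ?e ?x"
    using kernel_of_point[OF p sub ker(1)]
    by (intro pullback_along_zero[OF Z algs(1) P A p1 \<iota>])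
  have pb': "pullback \<V> ?b ?f' ?e ?x'"
    using kernel_of_point[OF p' subset_refl ker(2)]
    by (intro pullback_along_zero[OF Z algs(1) P' A p1' \<iota>'])
  have mor: "point_morphism \<V> ?f ?s ?f' ?s' (arr P P' ?h)"
  proof -
    have "arr P P' ?h \<in> hom \<V> P P'" using arr_in_hom[OF P P' h] .
    moreover have "?f' \<cdot>\<^bsub>\<V>\<^esub> arr P P' ?h = ?f"
      unfolding Comp_arr[OF h] arr_eq_iff using p'h by simp
    moreover have "arr P P' ?h \<cdot>\<^bsub>\<V>\<^esub> ?s = ?s'"
      unfolding Comp_arr[OF d] arr_eq_iff by (simp add: inv(2)[OF p diag(1)])
    ultimately show ?thesis unfolding point_morphism_def Dom_Cod_arr by simp
  qed
  have K_id: "arr K K (\<lambda>x. x) \<in> hom \<V> (Dom \<V> ?e) (Dom \<V> ?e)"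
    unfolding Dom_Cod_arr by (rule arr_in_hom[OF algs(1) algs(1) algebra_map_id])
  have e_id: "?e \<cdot>\<^bsub>\<V>\<^esub> arr K K (\<lambda>x. x) = ?e"
    by (simp only: Comp_arr[OF algebra_map_id])
  have x_id: "?x' \<cdot>\<^bsub>\<V>\<^esub> arr K K (\<lambda>x. x) = arr P P' ?h \<cdot>\<^bsub>\<V>\<^esub> ?x"
    unfolding Comp_arr[OF algebra_map_id] Comp_arr[OF \<iota>] arr_eq_iff
    by (simp add: inv(2)[OF p ker(1)])
  have iso: "iso \<V> (arr P P' ?h)"
    by (rule base_change_reflects_iso[OF arr_in_Arr[OF Z(1) A zero_map[OF A]]
          pt pt' mor pb pb' K_id e_id x_id iso_Id[OF algs(1)]])
  show ?thesis
  proof (rule equalityI[OF sub], rule subsetI)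
    fix x assume x: "x \<in> U X"
    then have "\<pi> x \<in> \<pi> ` U A" unfolding onto by (rule algebra_mapD(1)[OF \<pi>])
    then obtain a where a: "a \<in> U A" "\<pi> x = \<pi> a" by (rule imageE)
    have ax: "(a, x) \<in> W X" using a(1) x by (simp add: W_def a(2))
    obtain y where y: "y \<in> U P" "?h y = inv_into (U P') p' (a, x)"
      using iso_arr_surj[OF iso inv(1)[OF p' ax]] by blast
    have "p y = (a, x)"
      using p'h[OF y(1)] unfolding y(2) inv(2)[OF p' ax] by (rule sym)
    then show "x \<in> U A" using pW(1)[OF y(1)] by (simp add: W_def)
  qed
qed

definition lifted_generators ::
  "'a algebra \<Rightarrow> ('a \<Rightarrow> 'a) \<Rightarrow> ('a \<Rightarrow> 'a) \<Rightarrow> 'a + 'a \<Rightarrow> 'a" where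
  "lifted_generators X \<kappa> \<pi> = case_sum \<kappa> (inv_into (U X) \<pi>)"

abbreviation ext_terms :: "'a algebra \<Rightarrow> 'a algebra \<Rightarrow> ('a, 'a + 'a) gen_trm set" where
  "ext_terms K Q \<equiv> terms (elts (symbols V)) (arity V) (U K <+> U Q)"

lemma lifted_generators_closed:
  assumes "exact_sequence K X Q \<kappa> \<pi>" and "g \<in> U K <+> U Q"
  shows "lifted_generators X \<kappa> \<pi> g \<in> U X"
proof -
  have "inv_into (U X) \<pi> y \<in> U X" if "y \<in> U Q" for y
    using assms(1) that by (intro inv_into_into) (simp add: exact_sequence_def)
  moreover have "\<kappa> x \<in> U X" if "x \<in> U K" for x
    using assms(1) that algebra_mapD(1) unfolding exact_sequence_def by blast
  ultimately show ?thesis using assms(2) by (auto simp: lifted_generators_def)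
qed

text \<open>
  The values of terms form a subalgebra; the generators show that it contains the kernel and the
  chosen preimages, so it is everything by the short five lemma.
\<close>

lemma exact_sequence_generated:
  assumes E: "exact_sequence K X Q \<kappa> \<pi>"
  shows "gen_eval X (lifted_generators X \<kappa> \<pi>) ` ext_terms K Q = U X"
proof -
  let ?v = "lifted_generators X \<kappa> \<pi>"
  let ?S = "gen_eval X ?v ` ext_terms K Q"
  have X: "alg X" and \<pi>: "algebra_map X Q \<pi>" and onto: "\<pi> ` U X = U Q"
    using E by (simp_all add: exact_sequence_def)
  have sub: "?S \<subseteq> U X"
  proof (rule image_subsetI)
    fix t assume "t \<in> ext_terms K Q"
    then show "gen_eval X ?v t \<in> U X"
      using gen_eval_algebra_map[OF X algebra_map_id lifted_generators_closed[OF E] refl] by simp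
  qed
  obtain A where A: "alg A" "U A = ?S" "algebra_map A X (\<lambda>x. x)"
  proof (rule subalgebra[OF X sub])
    fix f xs assume f: "f \<in> elts (symbols V)" "length xs = arity V f" and xs: "set xs \<subseteq> ?S"
    let ?ts = "map (inv_into (ext_terms K Q) (gen_eval X ?v)) xs"
    have "map (gen_eval X ?v) ?ts = xs"
      using xs by (auto simp: f_inv_into_f subset_iff intro!: map_idI)
    then have eval: "gen_eval X ?v (Op f ?ts) = interp X f xs" by (simp del: map_map)
    have "\<forall>t\<in>set ?ts. t \<in> ext_terms K Q"
      using xs by (auto intro!: inv_into_into)
    then have "Op f ?ts \<in> ext_terms K Q" using f by (intro terms.Op) simp_all
    from imageI[OF this, of "gen_eval X ?v"] show "interp X f xs \<in> ?S" unfolding eval .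
  qed (rule that)
  have gen: "?v g \<in> ?S" if "g \<in> U K <+> U Q" for g
    using imageI[OF terms.Gen[OF that], of "gen_eval X ?v"] by simp
  have "\<kappa> ` U K \<subseteq> U A"
  proof (rule image_subsetI)
    show "\<kappa> x \<in> U A" if "x \<in> U K" for x
      using gen[OF InlI[OF that]] unfolding A(2) by (simp add: lifted_generators_def)
  qed
  moreover have "\<pi> ` U A = U Q"
  proof
    show "\<pi> ` U A \<subseteq> U Q" unfolding A(2) using image_mono[OF sub, of \<pi>] onto by simp
    show "U Q \<subseteq> \<pi> ` U A"
    proof
      fix y assume y: "y \<in> U Q"
      then have v: "\<pi> (?v (Inr y)) = y"
        using onto by (simp add: lifted_generators_def f_inv_into_f)
      have "?v (Inr y) \<in> U A" unfolding A(2) using gen[OF InrI[OF y]] .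
      from imageI[OF this, of \<pi>] show "y \<in> \<pi> ` U A" unfolding v .
    qed
  qed
  ultimately show ?thesis
    using subalgebra_over_exact_sequence[OF E A(1,3)] by (simp add: A(2))
qed

section \<open>Extensions are determined by term equations\<close>

definition term_equations ::
  "'a algebra \<Rightarrow> 'a algebra \<Rightarrow> 'a algebra \<Rightarrow> ('a \<Rightarrow> 'a) \<Rightarrow> ('a \<Rightarrow> 'a) \<Rightarrow>
    (('a, 'a + 'a) gen_trm \<times> ('a, 'a + 'a) gen_trm) set" where
  "term_equations K Q X \<kappa> \<pi> = {(t, t') \<in> ext_terms K Q \<times> ext_terms K Q.
    gen_eval X (lifted_generators X \<kappa> \<pi>) t = gen_eval X (lifted_generators X \<kappa> \<pi>) t'}"

text \<open>
  An extension is recovered from the equations that hold between terms in its generators: if all of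
  them hold in a second extension, sending the value of a term in the first to its value in the
  second is a morphism. It lies over \<open>Q\<close> because the image of a term in \<open>Q\<close> does not depend on the
  extension.
\<close>

lemma morphism_of_term_equations:
  assumes E: "exact_sequence K X Q \<kappa> \<pi>" and E': "exact_sequence K X' Q \<kappa>' \<pi>'"
    and eqs: "term_equations K Q X \<kappa> \<pi> \<subseteq> term_equations K Q X' \<kappa>' \<pi>'"
  obtains \<xi> where "algebra_map X X' \<xi>" and "\<And>x. x \<in> U K \<Longrightarrow> \<xi> (\<kappa> x) = \<kappa>' x"
    and "\<And>x. x \<in> U X \<Longrightarrow> \<pi>' (\<xi> x) = \<pi> x"
proof -
  let ?T = "ext_terms K Q"
  let ?v = "lifted_generators X \<kappa> \<pi>" and ?v' = "lifted_generators X' \<kappa>' \<pi>'"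
  let ?e = "gen_eval X ?v" and ?e' = "gen_eval X' ?v'"
  have X: "alg X" "alg X'" using E E' by (simp_all add: exact_sequence_def)
  have eT: "?e t \<in> U X" "?e' t \<in> U X'" if "t \<in> ?T" for t
    using gen_eval_algebra_map[OF X(1) algebra_map_id lifted_generators_closed[OF E] refl that]
      gen_eval_algebra_map[OF X(2) algebra_map_id lifted_generators_closed[OF E'] refl that]
    by simp_all
  define \<xi> where "\<xi> x = ?e' (inv_into ?T ?e x)" for x
  have inv: "inv_into ?T ?e x \<in> ?T" "?e (inv_into ?T ?e x) = x" if "x \<in> U X" for x
    using that unfolding exact_sequence_generated[OF E, symmetric]
    by (rule inv_into_into, intro f_inv_into_f)
  have \<xi>: "\<xi> (?e t) = ?e' t" if t: "t \<in> ?T" for t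
  proof -
    have "(inv_into ?T ?e (?e t), t) \<in> term_equations K Q X \<kappa> \<pi>"
      using inv[OF eT(1)[OF t]] t by (simp add: term_equations_def)
    then have "(inv_into ?T ?e (?e t), t) \<in> term_equations K Q X' \<kappa>' \<pi>'" using eqs by blast
    then show ?thesis by (simp add: term_equations_def \<xi>_def)
  qed
  have map: "algebra_map X X' \<xi>"
  proof (rule algebra_mapI)
    show "\<xi> x \<in> U X'" if "x \<in> U X" for x
      unfolding \<xi>_def by (rule eT(2)[OF inv(1)[OF that]])
    fix f xs assume f: "f \<in> elts (symbols V)" and xs: "xs \<in> arguments elts V X f"
    let ?ts = "map (inv_into ?T ?e) xs"
    have x: "x \<in> U X" if "x \<in> set xs" for x using xs that by (auto simp: arguments_def)
    have ts: "Op f ?ts \<in> ?T"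
      by (rule terms.Op[OF f]) (use xs x inv(1) in \<open>auto simp: arguments_def\<close>)
    have "map ?e ?ts = xs" using x inv(2) by (auto intro!: map_idI)
    moreover have "map ?e' ?ts = map \<xi> xs" by (simp add: \<xi>_def comp_def)
    ultimately show "\<xi> (interp X f xs) = interp X' f (map \<xi> xs)"
      using \<xi>[OF ts] by (simp del: map_map)
  qed
  have "\<xi> (\<kappa> x) = \<kappa>' x" if "x \<in> U K" for x
    using \<xi>[OF terms.Gen[OF InlI[OF that]]] by (simp add: lifted_generators_def)
  moreover have "\<pi>' (\<xi> x) = \<pi> x" if x: "x \<in> U X" for x
  proof -
    have proj: "\<rho> (gen_eval Y (lifted_generators Y \<mu> \<rho>) t) =
        gen_eval Q (case_sum (\<lambda>_. zero Q) (\<lambda>y. y)) t"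
      if F: "exact_sequence K Y Q \<mu> \<rho>" and t: "t \<in> ?T" for Y \<mu> \<rho> t
    proof -
      have Y: "alg Y" "algebra_map Y Q \<rho>" and ker: "\<mu> ` U K = {x \<in> U Y. \<rho> x = zero Q}"
        and onto: "\<rho> ` U Y = U Q"
        using F by (simp_all add: exact_sequence_def)
      have "\<rho> (\<mu> x) = zero Q" if "x \<in> U K" for x
        using ker imageI[OF that, of \<mu>] by simp
      moreover have "\<rho> (inv_into (U Y) \<rho> y) = y" if "y \<in> U Q" for y
        using onto that by (simp add: f_inv_into_f)
      ultimately have "\<rho> (lifted_generators Y \<mu> \<rho> g) = case_sum (\<lambda>_. zero Q) (\<lambda>y. y) g"
        if "g \<in> U K <+> U Q" for g
        using that by (auto simp: lifted_generators_def)
      then show ?thesis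
        using gen_eval_algebra_map[OF Y lifted_generators_closed[OF F] _ t] by simp
    qed
    show ?thesis
      using proj[OF E' inv(1)[OF x]] proj[OF E inv(1)[OF x]] inv(2)[OF x] by (simp add: \<xi>_def)
  qed
  ultimately show ?thesis using map by (intro that)
qed

text \<open>
  Extensions with the same term equations are connected in both directions, so a component is
  determined by a set of pairs of terms.
\<close>

lemma small_Ext1: "small elts (Ext1 \<V> Q K)"
proof -
  let ?C = "ext1_category \<V> Q K"
  let ?S = "short_exact_sequences \<V> K Q"
  define R where
    "R = {(E, E') \<in> Obj ?C \<times> Obj ?C. hom ?C E E' \<noteq> {} \<or> hom ?C E' E \<noteq> {}}"
  have Obj_C: "Obj ?C = ?S" by (simp add: ext1_category_def)
  \<comment> \<open>The arrows \<open>k\<close> and \<open>q\<close> determine \<open>\<kappa>\<close> and \<open>\<pi>\<close> only on the carriers, so one representation is chosen.\<close>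
  define eqs where "eqs E = (SOME \<epsilon>. \<exists>X \<kappa> \<pi>. E = (arr K X \<kappa>, arr X Q \<pi>) \<and>
    exact_sequence K X Q \<kappa> \<pi> \<and> \<epsilon> = term_equations K Q X \<kappa> \<pi>)" for E
  have eqs: "\<exists>X \<kappa> \<pi>. E = (arr K X \<kappa>, arr X Q \<pi>) \<and>
      exact_sequence K X Q \<kappa> \<pi> \<and> eqs E = term_equations K Q X \<kappa> \<pi>" if "E \<in> ?S" for E
  proof -
    obtain k q where "E = (k, q)" by (rule prod.exhaust)
    then have "(k, q) \<in> ?S" using that by simp
    then have "\<exists>\<epsilon> X \<kappa> \<pi>. E = (arr K X \<kappa>, arr X Q \<pi>) \<and>
        exact_sequence K X Q \<kappa> \<pi> \<and> \<epsilon> = term_equations K Q X \<kappa> \<pi>"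
    proof (rule short_exact_sequence_elements)
      fix X \<kappa> \<pi> assume "k = arr K X \<kappa>" "q = arr X Q \<pi>" "exact_sequence K X Q \<kappa> \<pi>"
      with \<open>E = (k, q)\<close> show ?thesis
        by (intro exI[of _ "term_equations K Q X \<kappa> \<pi>"] exI[of _ X] exI[of _ \<kappa>] exI[of _ \<pi>]) simp
    qed
    then show ?thesis unfolding eqs_def by (rule someI_ex)
  qed
  have connected: "(E, E') \<in> R" if E: "E \<in> ?S" and E': "E' \<in> ?S" and eq: "eqs E = eqs E'" for E E'
  proof -
    obtain X \<kappa> \<pi> where X: "E = (arr K X \<kappa>, arr X Q \<pi>)" "exact_sequence K X Q \<kappa> \<pi>"
      "eqs E = term_equations K Q X \<kappa> \<pi>"
      using eqs[OF E] by (elim exE conjE)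
    obtain X' \<kappa>' \<pi>' where X': "E' = (arr K X' \<kappa>', arr X' Q \<pi>')" "exact_sequence K X' Q \<kappa>' \<pi>'"
      "eqs E' = term_equations K Q X' \<kappa>' \<pi>'"
      using eqs[OF E'] by (elim exE conjE)
    have "term_equations K Q X \<kappa> \<pi> \<subseteq> term_equations K Q X' \<kappa>' \<pi>'"
      using eq unfolding X(3) X'(3) by (rule equalityD1)
    then obtain \<xi> where \<xi>: "algebra_map X X' \<xi>" "\<And>x. x \<in> U K \<Longrightarrow> \<xi> (\<kappa> x) = \<kappa>' x"
      "\<And>x. x \<in> U X \<Longrightarrow> \<pi>' (\<xi> x) = \<pi> x"
      by (rule morphism_of_term_equations[OF X(2) X'(2)]) (rule that)
    have X_facts: "alg X" "alg X'" "algebra_map K X \<kappa>"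
      using X(2) X'(2) by (simp_all add: exact_sequence_def)
    have "arr X X' \<xi> \<in> hom \<V> X X'" by (rule arr_in_hom[OF X_facts(1,2) \<xi>(1)])
    moreover have "arr X X' \<xi> \<cdot>\<^bsub>\<V>\<^esub> arr K X \<kappa> = arr K X' \<kappa>'"
      unfolding Comp_arr[OF X_facts(3)] arr_eq_iff by (simp add: \<xi>(2))
    moreover have "arr X' Q \<pi>' \<cdot>\<^bsub>\<V>\<^esub> arr X X' \<xi> = arr X Q \<pi>"
      unfolding Comp_arr[OF \<xi>(1)] arr_eq_iff by (simp add: \<xi>(3))
    ultimately have "(E, arr X X' \<xi>, E') \<in> hom ?C E E'"
      using E E' unfolding hom_def ext1_category_def X(1) X'(1) by simp
    then have "hom ?C E E' \<noteq> {}" by (metis empty_iff)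
    then show ?thesis unfolding R_def Obj_C using E E' by simp
  qed
  let ?T = "ext_terms K Q"
  have "small elts (U K <+> U Q)"
    unfolding Plus_def by (intro small_Un small_image small_elts)
  then have "small elts (Pow (?T \<times> ?T))"
    by (intro small_Pow small_Times small_terms small_elts)
  moreover have "Ext1 \<V> Q K \<subseteq>
      (\<lambda>\<epsilon>. R\<^sup>* `` {SOME E. E \<in> ?S \<and> eqs E = \<epsilon>}) ` Pow (?T \<times> ?T)" (is "_ \<subseteq> ?c ` _")
  proof
    fix c assume "c \<in> Ext1 \<V> Q K"
    then have "c \<in> ?S // R\<^sup>*"
      unfolding Ext1_def connected_components_def R_def Obj_C .
    then obtain E where E: "E \<in> ?S" and c: "c = R\<^sup>* `` {E}" by (rule quotientE)
    define E' where "E' = (SOME E'. E' \<in> ?S \<and> eqs E' = eqs E)"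
    have "E' \<in> ?S \<and> eqs E' = eqs E"
      unfolding E'_def by (rule someI[of _ E]) (simp add: E)
    then have E': "E' \<in> ?S" "eqs E' = eqs E" by simp_all
    have "(E, E') \<in> R\<^sup>*" "(E', E) \<in> R\<^sup>*"
      using connected[OF E E'(1) E'(2)[symmetric]] connected[OF E'(1) E E'(2)] by simp_all
    then have "(E, F) \<in> R\<^sup>* \<longleftrightarrow> (E', F) \<in> R\<^sup>*" for F
      using rtrancl_trans[of E E' R F] rtrancl_trans[of E' E R F] by argo
    then have "R\<^sup>* `` {E} = R\<^sup>* `` {E'}" by (simp add: Image_singleton)
    then have "c = ?c (eqs E)" unfolding c E'_def .
    moreover have "eqs E \<in> Pow (?T \<times> ?T)"
    proof -
      obtain X \<kappa> \<pi> where eqs_E: "eqs E = term_equations K Q X \<kappa> \<pi>"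
        using eqs[OF E] by (elim exE conjE)
      show ?thesis unfolding eqs_E term_equations_def by blast
    qed
    ultimately show "c \<in> ?c ` Pow (?T \<times> ?T)" by (rule image_eqI)
  qed
  ultimately show ?thesis by (rule small_subset[OF small_image])
qed

end

theorem theorem4p8:
  fixes elts :: "'u \<Rightarrow> 'u set" and V :: "'u variety" and K Q :: "'u algebra"
  assumes "grothendieck_universe elts"
    and "semi_abelian_variety elts V"
    and "K \<in> Obj (algebra_category elts V)"
    and "Q \<in> Obj (algebra_category elts V)"
  shows "small elts (Ext1 (algebra_category elts V) Q K)"
proof -
  interpret grothendieck_universe elts by (rule assms(1))
  interpret pointed_protomodular_variety elts V
    using assms(2)
    by unfold_locales (simp_all add: semi_abelian_variety_def semi_abelian_def)
  show ?thesis by (rule small_Ext1)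
qed

end
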